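(* Let $\Omega$ be a class of bounded self-adjoint operators on a separable Hilbert space and $\Lambda$ an evaluation set for $\Omega$, and suppose assumption (S2) holds for $(\Omega,\Lambda)$. Then $\{\underline{\dim}_{\mathrm{B}}(\mathrm{Sp}(\cdot)),\Omega,[0,1],\Lambda\}\in\Sigma_3^A$, $\{\overline{\dim}_{\mathrm{B}}(\mathrm{Sp}(\cdot)),\Omega,[0,1],\Lambda\}\in\Pi_2^A$, $\{\dim_{\mathrm{H}}(\mathrm{Sp}(\cdot)),\Omega,[0,1],\Lambda\}\in\Sigma_3^A$, and $\{\dim_{\mathrm{B}}(\mathrm{Sp}(\cdot)),\widehat\Omega,[0,1],\Lambda\}\in\Pi_2^A$, where $\widehat\Omega=\{A\in\Omega:\underline{\dim}_{\mathrm{B}}(\mathrm{Sp}(A))=\overline{\dim}_{\mathrm{B}}(\mathrm{Sp}(A))\}$.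
   Context: Assumption (S2) (spectral distance): using $\Lambda$ (finitely many evaluations together with finitely many arithmetic operations and comparisons, to any desired accuracy) one can compute functions $\Phi_n:\mathbb{R}\times\Omega\to\mathbb{R}$, $n\in\mathbb{N}$, such that for all $z\in\mathbb{R}$, $A\in\Omega$: $\mathrm{dist}(z,\mathrm{Sp}(A))\le\Phi_n(z,A)$ and $\lim_{n\to\infty}\Phi_n(z,A)=\mathrm{dist}(z,\mathrm{Sp}(A))$, uniformly on compact subsets of $\mathbb{R}$. Here $\mathrm{Sp}(A)$ is the spectrum. Box-counting dimensions: for bounded $F\subset\mathbb{R}$ let $N_\delta(F)$ be the number of intervals $[m\delta,(m+1)\delta]$, $m\in\mathbb{Z}$, meeting $F$; for a decreasing sequence $\delta_k$ with $\delta_{k+1}\ge c\delta_k$ ($c\in(0,1)$), $\underline{\dim}_{\mathrm{B}}(F)=\liminf_k\log N_{\delta_k}(F)/\log(1/\delta_k)$, $\overline{\dim}_{\mathrm{B}}(F)=\limsup_k\log N_{\delta_k}(F)/\log(1/\delta_k)$, and $\dim_{\mathrm{B}}(F)$ is their common value when equal. $\dim_{\mathrm{H}}$ is the Hausdorff dimension. Solvability Complexity Index (SCI) framework. A computational problem is a quadruple $\{\Xi,\Omega,\mathcal{M},\Lambda\}$: $\Omega$ is a set of inputs, $(\mathcal{M},d)$ a metric space, $\Xi:\Omega\to\mathcal{M}$ the quantity to compute, and $\Lambda$ a set of complex-valued functions on $\Omega$, such that $f(A)=f(B)$ for all $f\in\Lambda$ implies $\Xi(A)=\Xi(B)$. A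 general algorithm is a map $\Gamma:\Omega\to\mathcal{M}$ such that for each $A\in\Omega$ there is a finite set $\Lambda_\Gamma(A)\subset\Lambda$ with the property that whenever $B\in\Omega$ satisfies $f(B)=f(A)$ for all $f\in\Lambda_\Gamma(A)$, then $\Lambda_\Gamma(B)=\Lambda_\Gamma(A)$ and $\Gamma(B)=\Gamma(A)$. An arithmetic algorithm is a general algorithm whose output is computed from the values $\{f(A):f\in\Lambda_\Gamma(A)\}$ by finitely many real arithmetic operations and comparisons. A tower of algorithms of height $k$ is a family $\{\Gamma_{n_k,\dots,n_1}\}$ of algorithms such that for all $A\in\Omega$ the iterated limits $\Gamma_{n_k,\dots,n_2}(A)=\lim_{n_1\to\infty}\Gamma_{n_k,\dots,n_1}(A)$, $\dots$, $\Gamma_{n_k}(A)=\lim_{n_{k-1}\to\infty}\Gamma_{n_k,n_{k-1}}(A)$ exist in $\mathcal{M}$ and $\Xi(A)=\lim_{n_k\to\infty}\Gamma_{n_k}(A)$. For $\alpha=A$ (arithmetic) or $\alpha=G$ (general): the problem is in $\Delta_1^\alpha$ if there are algorithms $\Gamma_n$ of type $\alpha$ with $d(\Gamma_n(A),\Xi(A))\le 2^{-n}$ for all $A,n$; in $\Delta_{k+1}^\alpha$ ($k\ge1$) if it admits a tower of height $k$ of type $\alpha$. When $\mathcal{M}$ is totally ordered, it is in $\Sigma_k^\alpha$ (resp. $\Pi_k^\alpha$), $k\ge1$, if it is in $\Delta_{k+1}^\alpha$ and admits a tower of height $k$ of type $\alpha$ with $\Gamma_{n_k}(A)$ nondecreasing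 (resp. nonincreasing) in $n_k$ and converging to $\Xi(A)$ for every $A\in\Omega$. *)

theory Defs
  imports "HOL-Analysis.Analysis"
begin

text \<open>Bounded operators on a (real) Hilbert space 'h are elements of the library
type of bounded linear functions.  A bounded operator is self-adjoint if it is
symmetric for the inner product.  Its spectrum (a subset of the reals for
self-adjoint operators) is the set of z such that A - z I is not bijective
(by the open mapping theorem this is the same as: not boundedly invertible).\<close>

definition self_adjoint :: "('h::{real_inner,complete_space} \<Rightarrow>\<^sub>L 'h) \<Rightarrow> bool" where
  "self_adjoint A \<longleftrightarrow> (\<forall>x y. inner (blinfun_apply A x) y = inner x (blinfun_apply A y))"

definition Sp :: "('h::{real_inner,complete_space} \<Rightarrow>\<^sub>L 'h) \<Rightarrow> real set" where
  "Sp A = {z. \<not> bij (\<lambda>x. blinfun_apply A x - z *\<^sub>R x)}"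

definition N_count :: "real \<Rightarrow> real set \<Rightarrow> nat" where
  "N_count \<delta> F = card {m::int. {of_int m * \<delta> .. (of_int m + 1) * \<delta>} \<inter> F \<noteq> {}}"

text \<open>Lower/upper box-counting dimension, computed along the sequence
delta_k = 2^-k (which satisfies delta_(k+1) >= c delta_k with c = 1/2).\<close>

definition lower_box_dim :: "real set \<Rightarrow> real" where
  "lower_box_dim F = real_of_ereal (liminf (\<lambda>k::nat.
      ereal (ln (real (N_count ((1/2)^k) F)) / ln (2^k))))"

definition upper_box_dim :: "real set \<Rightarrow> real" where
  "upper_box_dim F = real_of_ereal (limsup (\<lambda>k::nat.
      ereal (ln (real (N_count ((1/2)^k) F)) / ln (2^k))))"

definition hausdorff_pre :: "real \<Rightarrow> real \<Rightarrow> real set \<Rightarrow> ennreal" where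
  "hausdorff_pre s \<delta> F =
     (INF U \<in> {U :: nat \<Rightarrow> real set. F \<subseteq> (\<Union>i. U i) \<and>
                  (\<forall>i. bounded (U i) \<and> diameter (U i) \<le> \<delta>)}.
        (\<Sum>i. ennreal (diameter (U i) powr s)))"

definition hausdorff_measure :: "real \<Rightarrow> real set \<Rightarrow> ennreal" where
  "hausdorff_measure s F = (SUP \<delta> \<in> {0<..}. hausdorff_pre s \<delta> F)"

definition hausdorff_dim :: "real set \<Rightarrow> real" where
  "hausdorff_dim F = Inf {s. s > 0 \<and> hausdorff_measure s F = 0}"

datatype aexp = Var nat | Const rat | Add aexp aexp | Sub aexp aexp
  | Mul aexp aexp | Dvd aexp aexp

fun aeval :: "aexp \<Rightarrow> real list \<Rightarrow> real" where
  "aeval (Var i) vs = (if i < length vs then vs ! i else 0)"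
| "aeval (Const q) vs = of_rat q"
| "aeval (Add a b) vs = aeval a vs + aeval b vs"
| "aeval (Sub a b) vs = aeval a vs - aeval b vs"
| "aeval (Mul a b) vs = aeval a vs * aeval b vs"
| "aeval (Dvd a b) vs = aeval a vs / aeval b vs"

codatatype 'f ctree = Leaf aexp | Ask 'f "'f ctree" | Test aexp aexp "'f ctree" "'f ctree"

inductive runs :: "('a \<Rightarrow> complex) set \<Rightarrow> ('a \<Rightarrow> complex) ctree \<Rightarrow> 'a \<Rightarrow> real list \<Rightarrow> real \<Rightarrow> bool"
  for Lam :: "('a \<Rightarrow> complex) set" where
  run_leaf: "runs Lam (Leaf e) A vs (aeval e vs)"
| run_ask: "f \<in> Lam \<Longrightarrow> runs Lam t A (vs @ [Re (f A), Im (f A)]) r \<Longrightarrow> runs Lam (Ask f t) A vs r"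
| run_le: "aeval e1 vs \<le> aeval e2 vs \<Longrightarrow> runs Lam t1 A vs r \<Longrightarrow> runs Lam (Test e1 e2 t1 t2) A vs r"
| run_gt: "\<not> aeval e1 vs \<le> aeval e2 vs \<Longrightarrow> runs Lam t2 A vs r \<Longrightarrow> runs Lam (Test e1 e2 t1 t2) A vs r"

text \<open>An arithmetic algorithm on inputs Om with evaluation set Lam.  (The general
algorithm consistency condition holds automatically: Lam_Gamma(A) is the finite
set of functions queried along the computation path of A.)\<close>

definition arith_alg :: "'a set \<Rightarrow> ('a \<Rightarrow> complex) set \<Rightarrow> ('a \<Rightarrow> real) \<Rightarrow> bool" where
  "arith_alg Om Lam G \<longleftrightarrow> (\<exists>t. \<forall>A\<in>Om. runs Lam t A [] (G A))"

definition Pi2_A :: "'a set \<Rightarrow> ('a \<Rightarrow> complex) set \<Rightarrow> ('a \<Rightarrow> real) \<Rightarrow> bool" where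
  "Pi2_A Om Lam Xi \<longleftrightarrow>
     (\<exists>(G :: nat \<Rightarrow> nat \<Rightarrow> 'a \<Rightarrow> real) (G2 :: nat \<Rightarrow> 'a \<Rightarrow> real).
        (\<forall>n2 n1. arith_alg Om Lam (G n2 n1) \<and> (\<forall>A\<in>Om. G n2 n1 A \<in> {0..1})) \<and>
        (\<forall>A\<in>Om. \<forall>n2. (\<lambda>n1. G n2 n1 A) \<longlonglongrightarrow> G2 n2 A) \<and>
        (\<forall>A\<in>Om. (\<lambda>n2. G2 n2 A) \<longlonglongrightarrow> Xi A) \<and>
        (\<forall>A\<in>Om. decseq (\<lambda>n2. G2 n2 A)))"

definition Sigma3_A :: "'a set \<Rightarrow> ('a \<Rightarrow> complex) set \<Rightarrow> ('a \<Rightarrow> real) \<Rightarrow> bool" where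
  "Sigma3_A Om Lam Xi \<longleftrightarrow>
     (\<exists>(G :: nat \<Rightarrow> nat \<Rightarrow> nat \<Rightarrow> 'a \<Rightarrow> real) (G2 :: nat \<Rightarrow> nat \<Rightarrow> 'a \<Rightarrow> real)
        (G3 :: nat \<Rightarrow> 'a \<Rightarrow> real).
        (\<forall>n3 n2 n1. arith_alg Om Lam (G n3 n2 n1) \<and> (\<forall>A\<in>Om. G n3 n2 n1 A \<in> {0..1})) \<and>
        (\<forall>A\<in>Om. \<forall>n3 n2. (\<lambda>n1. G n3 n2 n1 A) \<longlonglongrightarrow> G2 n3 n2 A) \<and>
        (\<forall>A\<in>Om. \<forall>n3. (\<lambda>n2. G2 n3 n2 A) \<longlonglongrightarrow> G3 n3 A) \<and>
        (\<forall>A\<in>Om. (\<lambda>n3. G3 n3 A) \<longlonglongrightarrow> Xi A) \<and>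
        (\<forall>A\<in>Om. incseq (\<lambda>n3. G3 n3 A)))"

definition assumption_S2 :: "'a set \<Rightarrow> ('a \<Rightarrow> complex) set \<Rightarrow> ('a \<Rightarrow> real set) \<Rightarrow> bool" where
  "assumption_S2 Om Lam Spec \<longleftrightarrow>
     (\<exists>Phi :: nat \<Rightarrow> real \<Rightarrow> 'a \<Rightarrow> real.
        (\<forall>n z m. \<exists>G. arith_alg Om Lam G \<and> (\<forall>A\<in>Om. \<bar>G A - Phi n z A\<bar> \<le> (1/2)^m)) \<and>
        (\<forall>n z. \<forall>A\<in>Om. infdist z (Spec A) \<le> Phi n z A) \<and>
        (\<forall>A\<in>Om. \<forall>K. compact K \<longrightarrow>
            uniform_limit K (\<lambda>n z. Phi n z A) (\<lambda>z. infdist z (Spec A)) sequentially))"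

end

theory Submission
  imports Defs
begin

text \<open>The spectrum is compact and nonempty, and a comparison \<open>\<Phi>\<^sub>n(z, A) \<le> s\<close> certifies that it meets
the closed ball of radius \<open>s\<close> around \<open>z\<close>.  Hence, for open \<open>U\<close>, meeting \<open>U\<close> is
semidecidable, uniformly in \<open>A\<close>, and any rational function of finitely many such
certificates is an arithmetic algorithm.

Counting fattened dyadic intervals gives, in one limit and from below, numbers comparable to
\<open>N_count\<close>.  Taking maxima (minima) of the resulting rates over \<open>k \<ge> n\<close> yields the decreasing
(increasing) tails whose limits are the upper (lower) box dimension.

For compact \<open>F\<close> and \<open>s > 0\<close>, the measure \<open>H\<^sup>s(F)\<close> vanishes iff \<open>F\<close> has covers by finitely many closed
rational intervals with arbitrarily small total \<open>s\<close>-weight.  Whether a given finite union of closed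
intervals covers \<open>F\<close> is decided in one limit; running through all covers takes the second limit; and
the largest \<open>s\<close> in a dyadic grid for which all covers weigh at least \<open>1 / (n + 1)\<close> increases to the
Hausdorff dimension.\<close>

subsection \<open>Decision trees\<close>

fun shift :: "nat \<Rightarrow> aexp \<Rightarrow> aexp" where
  "shift L (Var i) = Var (L + i)"
| "shift L (Const q) = Const q"
| "shift L (Add a b) = Add (shift L a) (shift L b)"
| "shift L (Sub a b) = Sub (shift L a) (shift L b)"
| "shift L (Mul a b) = Mul (shift L a) (shift L b)"
| "shift L (Dvd a b) = Dvd (shift L a) (shift L b)"

text \<open>An out-of-range variable stays out of range after shifting, so both sides then take the
  default 0.\<close>

lemma aeval_shift: "aeval (shift (length us) e) (us @ vs) = aeval e vs"
  by (induction e) (auto simp: nth_append)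

text \<open>Runs a tree below a stack of \<open>L\<close> older values (\<open>l\<close> is the current stack height) and
branches at its leaves according to whether the result is at most \<open>q\<close>.\<close>

primcorec graft ::
  "nat \<Rightarrow> rat \<Rightarrow> (nat \<Rightarrow> 'f ctree) \<Rightarrow> (nat \<Rightarrow> 'f ctree) \<Rightarrow> nat \<Rightarrow> 'f ctree \<Rightarrow> 'f ctree" where
  "is_Ask t \<Longrightarrow> graft L q X Y l t =
     Ask (case t of Ask f t' \<Rightarrow> f) (graft L q X Y (l + 2) (case t of Ask f t' \<Rightarrow> t'))"
| "\<not> is_Ask t \<Longrightarrow> graft L q X Y l t =
     Test (case t of Leaf e \<Rightarrow> shift L e | Test e1 e2 t1 t2 \<Rightarrow> shift L e1)
          (case t of Leaf e \<Rightarrow> Const q | Test e1 e2 t1 t2 \<Rightarrow> shift L e2)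
          (case t of Leaf e \<Rightarrow> X l | Test e1 e2 t1 t2 \<Rightarrow> graft L q X Y l t1)
          (case t of Leaf e \<Rightarrow> Y l | Test e1 e2 t1 t2 \<Rightarrow> graft L q X Y l t2)"

lemma graft_simps [simp]:
  "graft L q X Y l (Leaf e) = Test (shift L e) (Const q) (X l) (Y l)"
  "graft L q X Y l (Ask f t) = Ask f (graft L q X Y (l + 2) t)"
  "graft L q X Y l (Test e1 e2 t1 t2) =
     Test (shift L e1) (shift L e2) (graft L q X Y l t1) (graft L q X Y l t2)"
  by (simp_all add: graft.ctr)

text \<open>Induction along the run of \<open>t\<close>. The stack height at a leaf depends on the
  path taken, so the continuations have to be correct on every stack \<open>ws\<close>.\<close>

lemma runs_graft:
  assumes "runs Lam t A vs r"
    and X: "r \<le> of_rat q \<Longrightarrow> \<forall>ws. runs Lam (X (length ws)) A ws a"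
    and Y: "\<not> r \<le> of_rat q \<Longrightarrow> \<forall>ws. runs Lam (Y (length ws)) A ws a"
  shows "runs Lam (graft (length us) q X Y (length us + length vs) t) A (us @ vs) a"
  using assms
proof (induction)
  case (run_leaf e A vs)
  have *: "length us + length vs = length (us @ vs)" by simp
  show ?case
  proof (cases "aeval e vs \<le> of_rat q")
    case True
    then show ?thesis using run_leaf unfolding graft_simps *
      by (intro run_le) (auto simp only: aeval_shift aeval.simps)
  next
    case False
    then show ?thesis using run_leaf unfolding graft_simps *
      by (intro run_gt) (auto simp only: aeval_shift aeval.simps)
  qed
next
  case (run_ask f t A vs r)
  then show ?case by (auto intro!: runs.run_ask)
next
  case (run_le e1 vs e2 t1 A r t2)
  then show ?case by (auto intro!: runs.run_le simp: aeval_shift)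
next
  case (run_gt e1 vs e2 t2 A r t1)
  then show ?case by (auto intro!: runs.run_gt simp: aeval_shift)
qed

text \<open>Unlike \<^const>\<open>arith_alg\<close>, the computation may start on an arbitrary stack, which makes the
notion closed under branching.\<close>

definition stack_alg :: "'a set \<Rightarrow> ('a \<Rightarrow> complex) set \<Rightarrow> ('a \<Rightarrow> real) \<Rightarrow> bool" where
  "stack_alg Om Lam X \<longleftrightarrow> (\<exists>T. \<forall>A\<in>Om. \<forall>vs. runs Lam (T (length vs)) A vs (X A))"

lemma stack_alg_imp_arith_alg: "stack_alg Om Lam X \<Longrightarrow> arith_alg Om Lam X"
  unfolding stack_alg_def arith_alg_def by (metis list.size(3))

lemma stack_alg_const: "stack_alg Om Lam (\<lambda>A. of_rat q)"
  unfolding stack_alg_def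
  by (rule exI[of _ "\<lambda>_. Leaf (Const q)"]) (metis aeval.simps(2) run_leaf)

text \<open>Grafting lets a tree written for the empty stack run above older values, so
  \<open>G\<close> may be an ordinary algorithm while the branches accept any stack.\<close>

lemma stack_alg_if:
  assumes G: "arith_alg Om Lam G" and X: "stack_alg Om Lam X" and Y: "stack_alg Om Lam Y"
  shows "stack_alg Om Lam (\<lambda>A. if G A \<le> of_rat q then X A else Y A)"
proof -
  obtain t where t: "\<forall>A\<in>Om. runs Lam t A [] (G A)" using G unfolding arith_alg_def by blast
  obtain TX where TX: "\<forall>A\<in>Om. \<forall>vs. runs Lam (TX (length vs)) A vs (X A)"
    using X unfolding stack_alg_def by blast
  obtain TY where TY: "\<forall>A\<in>Om. \<forall>vs. runs Lam (TY (length vs)) A vs (Y A)"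
    using Y unfolding stack_alg_def by blast
  have "runs Lam (graft (length vs) q TX TY (length vs) t) A vs
          (if G A \<le> of_rat q then X A else Y A)" if "A \<in> Om" for A vs
    using runs_graft[OF bspec[OF t that], of q TX "if G A \<le> of_rat q then X A else Y A" TY vs]
      TX TY that by auto
  then show ?thesis unfolding stack_alg_def
    by (intro exI[of _ "\<lambda>l. graft l q TX TY l t"]) blast
qed

text \<open>Finitely many tests have finitely many outcomes, so any map \<open>g\<close> of the set
  of passed tests can be hard-wired into the leaves. The induction branches on one test and absorbs
  its outcome into \<open>g\<close>.\<close>

lemma arith_alg_finite_tests:
  fixes G :: "'i \<Rightarrow> 'a \<Rightarrow> real" and q :: "'i \<Rightarrow> rat" and g :: "'i set \<Rightarrow> rat"
  assumes "finite I" "\<And>i. i \<in> I \<Longrightarrow> arith_alg Om Lam (G i)"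
  shows "arith_alg Om Lam (\<lambda>A. of_rat (g {i\<in>I. G i A \<le> of_rat (q i)}))"
proof (rule stack_alg_imp_arith_alg)
  show "stack_alg Om Lam (\<lambda>A. of_rat (g {i\<in>I. G i A \<le> of_rat (q i)}))"
    using assms
  proof (induction I arbitrary: g rule: finite_induct)
    case empty
    then show ?case by (simp add: stack_alg_const)
  next
    case (insert j I)
    have "stack_alg Om Lam (\<lambda>A. of_rat (g (insert j {i\<in>I. G i A \<le> of_rat (q i)})))"
      using insert.IH[of "\<lambda>S. g (insert j S)"] insert.prems by blast
    moreover have "stack_alg Om Lam (\<lambda>A. of_rat (g {i\<in>I. G i A \<le> of_rat (q i)}))"
      using insert.IH[of g] insert.prems by blast
    ultimately have *: "stack_alg Om Lam (\<lambda>A. if G j A \<le> of_rat (q j)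
        then of_rat (g (insert j {i\<in>I. G i A \<le> of_rat (q i)}))
        else of_rat (g {i\<in>I. G i A \<le> of_rat (q i)}))"
      using insert.prems by (intro stack_alg_if) auto
    have "{i\<in>insert j I. G i A \<le> of_rat (q i)} = (if G j A \<le> of_rat (q j)
        then insert j {i\<in>I. G i A \<le> of_rat (q i)} else {i\<in>I. G i A \<le> of_rat (q i)})" for A
      by auto
    then show ?case using * by (simp only: if_distrib[of "\<lambda>S. real_of_rat (g S)"])
  qed
qed

subsection \<open>The spectrum of a self-adjoint operator\<close>

lemma Baire_interior:
  fixes E :: "nat \<Rightarrow> 'a::complete_space set"
  assumes "\<And>n. closed (E n)" "(\<Union>n. E n) = UNIV"
  shows "\<exists>n. interior (E n) \<noteq> {}"
proof (rule ccontr)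
  assume "\<not> ?thesis"
  then have "euclidean interior_of \<Union> (range E) = {}"
    using assms(1) completely_metrizable_space_euclidean
    by (intro Baire_category_alt) auto
  then show False using assms(2) by simp
qed

lemma linear_inv_bij:
  assumes "linear T" "bij T"
  shows "linear (inv T)"
proof (rule linearI)
  have *: "T (inv T y) = y" "inv T (T x) = x" for x y
    using assms(2) by (simp_all add: bij_is_surj surj_f_inv_f bij_is_inj)
  show "inv T (x + y) = inv T x + inv T y" for x y
    using *(2)[of "inv T x + inv T y"] by (simp add: * linear_add[OF assms(1)])
  show "inv T (c *\<^sub>R x) = c *\<^sub>R inv T x" for c x
    using *(2)[of "c *\<^sub>R inv T x"] by (simp add: * linear_scale[OF assms(1)])
qed

text \<open>For symmetric \<open>T\<close> the sublevel sets \<open>{y. norm (T\<^sup>-\<^sup>1 y) \<le> n}\<close> are closed because \<open>T\<^sup>-\<^sup>1\<close> is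
symmetric as well; this replaces the open mapping theorem.\<close>

lemma symmetric_inverse_bounded:
  fixes T :: "'h::{real_inner,complete_space} \<Rightarrow> 'h"
  assumes lin: "linear T" and sym: "\<And>x y. T x \<bullet> y = x \<bullet> T y" and bij: "bij T"
  obtains K where "K > 0" "\<And>y. norm (inv T y) \<le> K * norm y"
proof -
  define S where "S = inv T"
  have TS [simp]: "T (S y) = y" for y
    unfolding S_def using bij by (simp add: bij_is_surj surj_f_inv_f)
  have linS: "linear S"
    unfolding S_def using lin bij by (rule linear_inv_bij)
  have symS: "S x \<bullet> y = x \<bullet> S y" for x y
    using sym[of "S x" "S y"] by simp
  define E where "E n = {y. norm (S y) \<le> real n}" for n
  \<comment> \<open>For each fixed \<open>x\<close> the condition on the right is visibly closed in
    \<open>y\<close>; taking \<open>x = S y\<close> recovers the norm bound.\<close>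
  have "E n = (\<Inter>x. {y. S x \<bullet> y \<le> real n * norm x})" for n
  proof (intro set_eqI iffI)
    fix y assume "y \<in> E n"
    then have y: "norm (S y) \<le> real n" by (simp add: E_def)
    have "S x \<bullet> y \<le> real n * norm x" for x
    proof -
      have "S x \<bullet> y \<le> norm x * norm (S y)" unfolding symS by (rule norm_cauchy_schwarz)
      also have "\<dots> \<le> norm x * real n" using y by (intro mult_left_mono) auto
      finally show ?thesis by (simp add: mult.commute)
    qed
    then show "y \<in> (\<Inter>x. {y. S x \<bullet> y \<le> real n * norm x})" by simp
  next
    fix y assume "y \<in> (\<Inter>x. {y. S x \<bullet> y \<le> real n * norm x})"
    then have "S (S y) \<bullet> y \<le> real n * norm (S y)" by blast
    then have "S y \<bullet> S y \<le> real n * norm (S y)" by (simp only: symS[of "S y" y])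
    then have "norm (S y) * norm (S y) \<le> real n * norm (S y)"
      by (simp add: dot_square_norm power2_eq_square)
    then show "y \<in> E n" unfolding E_def
      by (cases "S y = 0") auto
  qed
  moreover have "closed {y. S x \<bullet> y \<le> real n * norm x}" for x n
    by (intro closed_Collect_le continuous_intros)
  ultimately have "closed (E n)" for n by auto
  moreover have "(\<Union>n. E n) = UNIV" unfolding E_def by (auto intro: real_arch_simple)
  ultimately obtain n where "interior (E n) \<noteq> {}" using Baire_interior by blast
  then obtain a e where e: "e > 0" "ball a e \<subseteq> E n"
    by (metis all_not_in_conv mem_interior)
  \<comment> \<open>A small \<open>y\<close> is the difference of \<open>a + y\<close> and
    \<open>a\<close>, both in \<open>E n\<close>; hence the factor 2.\<close>
  have small: "norm (S y) \<le> 2 * real n" if "norm y < e" for y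
  proof -
    have "a \<in> E n" "a + y \<in> E n" using e that by (auto simp: subset_iff dist_norm)
    moreover have "S y = S (a + y) - S a" using linear_add[OF linS] by simp
    ultimately show ?thesis unfolding E_def
      using norm_triangle_ineq4[of "S (a + y)" "S a"] by simp
  qed
  \<comment> \<open>Rescaling \<open>y\<close> to norm \<open>e / 2\<close> gives the factor
    \<open>4 * real n / e\<close>; adding 1 keeps the constant positive when
    \<open>n = 0\<close>.\<close>
  have "norm (S y) \<le> (4 * real n / e + 1) * norm y" for y
  proof (cases "y = 0")
    case True
    then show ?thesis using linear_0[OF linS] by simp
  next
    case False
    define c where "c = e / 2 / norm y"
    have c: "c > 0" using False e by (simp add: c_def)
    have "norm (c *\<^sub>R y) = e / 2" using e False by (simp add: c_def)
    then have "norm (S (c *\<^sub>R y)) \<le> 2 * real n" using e by (intro small) simp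
    then have "c * norm (S y) \<le> 2 * real n" using c linear_scale[OF linS] by simp
    then have "norm (S y) \<le> 4 * real n / e * norm y"
      using False e by (simp add: c_def field_simps)
    also have "\<dots> \<le> (4 * real n / e + 1) * norm y" by (intro mult_right_mono) auto
    finally show ?thesis .
  qed
  then show ?thesis using that[of "4 * real n / e + 1"] e unfolding S_def
    by (simp add: add_nonneg_pos)
qed

text \<open>The equation \<open>T x - B x = y\<close> says that \<open>x\<close> is a fixed point of
  the map sending \<open>x\<close> to \<open>inv T (y + B x)\<close>, a contraction with factor
  \<open>K * L\<close>.\<close>

lemma bij_diff_Lipschitz:
  fixes T B :: "'h::{real_normed_vector,complete_space} \<Rightarrow> 'h"
  assumes lin: "linear T" and bij: "bij T"
    and K: "K > 0" "\<And>y. norm (inv T y) \<le> K * norm y"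
    and B: "\<And>x y. norm (B x - B y) \<le> L * norm (x - y)" and L: "L \<ge> 0" "K * L < 1"
  shows "bij (\<lambda>x. T x - B x)"
proof -
  have TS [simp]: "T (inv T y) = y" and ST [simp]: "inv T (T x) = x" for x y
    using bij by (simp_all add: bij_is_surj surj_f_inv_f bij_is_inj)
  have linS: "linear (inv T)"
    using lin bij by (rule linear_inv_bij)
  have "\<exists>!x. T x - B x = y" for y
  proof -
    have "\<exists>!x. inv T (y + B x) = x"
    proof (rule banach_fix_type[of "K * L"])
      show "\<forall>x x'. dist (inv T (y + B x)) (inv T (y + B x')) \<le> K * L * dist x x'"
      proof (intro allI)
        fix x x'
        have "dist (inv T (y + B x)) (inv T (y + B x')) = norm (inv T (B x - B x'))"
          by (simp add: dist_norm flip: linear_diff[OF linS])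
        also have "\<dots> \<le> K * norm (B x - B x')" by (rule K)
        also have "\<dots> \<le> K * (L * norm (x - x'))" using K B by (intro mult_left_mono) auto
        finally show "dist (inv T (y + B x)) (inv T (y + B x')) \<le> K * L * dist x x'"
          by (simp add: dist_norm)
      qed
    qed (use K L in auto)
    moreover have "inv T (y + B x) = x \<longleftrightarrow> T x - B x = y" for x
    proof
      assume "inv T (y + B x) = x"
      then have "T (inv T (y + B x)) = T x" by (rule arg_cong)
      then have "y + B x = T x" unfolding TS .
      then show "T x - B x = y" by (metis add_diff_cancel_right')
    next
      assume "T x - B x = y"
      then show "inv T (y + B x) = x" by auto
    qed
    ultimately show ?thesis by simp
  qed
  then show ?thesis by (simp add: bij_iff)
qed

text \<open>\<open>Sp\<close> speaks of bijectivity only; symmetry supplies the bounded inverse that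
  perturbation arguments use.\<close>

lemma self_adjoint_resolvent_bounded:
  fixes A :: "'h::{real_inner,complete_space} \<Rightarrow>\<^sub>L 'h"
  assumes "self_adjoint A" "z \<notin> Sp A"
  obtains K where "K > 0" "\<And>y. norm (inv (\<lambda>x. A x - z *\<^sub>R x) y) \<le> K * norm y"
proof (rule symmetric_inverse_bounded)
  show "linear (\<lambda>x. A x - z *\<^sub>R x)"
    by (intro linear_compose_sub bounded_linear.linear blinfun.bounded_linear_right
        bounded_linear_scaleR_right)
  show "(A x - z *\<^sub>R x) \<bullet> y = x \<bullet> (A y - z *\<^sub>R y)" for x y
    using assms(1) by (simp add: self_adjoint_def inner_diff_left inner_diff_right)
  show "bij (\<lambda>x. A x - z *\<^sub>R x)" using assms(2) by (simp add: Sp_def)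
qed (rule that)

text \<open>Write \<open>A - w\<close> as \<open>(A - z) - (w - z)\<close>: bijectivity persists
  while \<open>|w - z| < 1 / K\<close>, so the complement is open.\<close>

lemma closed_Sp:
  assumes "self_adjoint A"
  shows "closed (Sp A)"
proof -
  have "open (- Sp A)" unfolding open_contains_ball
  proof
    fix z assume "z \<in> - Sp A"
    then have z: "z \<notin> Sp A" by simp
    then obtain K where K: "K > 0" "\<And>y. norm (inv (\<lambda>x. A x - z *\<^sub>R x) y) \<le> K * norm y"
      using self_adjoint_resolvent_bounded[OF assms] by blast
    have "w \<notin> Sp A" if "w \<in> ball z (1 / K)" for w
    proof -
      have "bij (\<lambda>x. (A x - z *\<^sub>R x) - (w - z) *\<^sub>R x)"
      proof (rule bij_diff_Lipschitz[OF _ _ K])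
        show "linear (\<lambda>x. A x - z *\<^sub>R x)"
          by (intro linear_compose_sub bounded_linear.linear blinfun.bounded_linear_right
              bounded_linear_scaleR_right)
        show "bij (\<lambda>x. A x - z *\<^sub>R x)" using z by (simp add: Sp_def)
        show "norm ((w - z) *\<^sub>R x - (w - z) *\<^sub>R y) \<le> \<bar>w - z\<bar> * norm (x - y)" for x y
          by (simp flip: scaleR_diff_right)
        show "K * \<bar>w - z\<bar> < 1" using that K by (simp add: dist_real_def abs_minus_commute field_simps)
      qed auto
      then show ?thesis by (simp add: Sp_def algebra_simps)
    qed
    then show "\<exists>e>0. ball z e \<subseteq> - Sp A" using K by (intro exI[of _ "1 / K"]) auto
  qed
  then show ?thesis by (simp add: closed_def)
qed

text \<open>For \<open>|z| > norm A\<close>, the operator \<open>A - z\<close> perturbs the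
  invertible map \<open>- z\<close> times the identity, whose inverse has bound
  \<open>1 / |z|\<close>, by a \<open>norm A\<close>-Lipschitz map.\<close>

lemma Sp_subset_cball: "Sp A \<subseteq> cball 0 (norm A)"
proof
  fix z assume z: "z \<in> Sp A"
  show "z \<in> cball 0 (norm A)"
  proof (rule ccontr)
    assume "z \<notin> cball 0 (norm A)"
    then have nz: "\<bar>z\<bar> > norm A" "\<bar>z\<bar> > 0" using norm_ge_zero[of A] by (auto simp del: norm_ge_zero)
    have bij: "bij (\<lambda>x::'a. (- z) *\<^sub>R x)"
      using nz by (intro o_bij[of "\<lambda>x. (- 1 / z) *\<^sub>R x"]) (auto simp: o_def)
    have inv: "inv (\<lambda>x::'a. (- z) *\<^sub>R x) = (\<lambda>x. (- 1 / z) *\<^sub>R x)"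
      using nz by (intro inv_equality) auto
    have "bij (\<lambda>x. (- z) *\<^sub>R x - (- A x))"
    proof (rule bij_diff_Lipschitz[OF _ bij])
      show "linear (\<lambda>x::'a. (- z) *\<^sub>R x)" by (rule linear_scaleR)
      show "norm (inv (\<lambda>x::'a. (- z) *\<^sub>R x) y) \<le> 1 / \<bar>z\<bar> * norm y" for y
        unfolding inv by simp
      show "norm (- A x - (- A y)) \<le> norm A * norm (x - y)" for x y
        using norm_blinfun[of A "x - y"] by (simp add: blinfun.diff_right norm_minus_commute)
    qed (use nz in \<open>auto simp: field_simps\<close>)
    then show False using z by (simp add: Sp_def)
  qed
qed

lemma compact_Sp: "self_adjoint A \<Longrightarrow> compact (Sp A)"
  unfolding compact_eq_bounded_closed
  by (blast intro: closed_Sp bounded_subset[OF bounded_cball Sp_subset_cball])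

text \<open>One of \<open>\<plusminus> norm A\<close> lies in the spectrum: otherwise \<open>A\<^sup>2 - (norm A)\<^sup>2\<close> is bounded below, while
\<open>norm (A\<^sup>2 x - N\<^sup>2 x)\<^sup>2 \<le> N\<^sup>2 (N\<^sup>2 norm x\<^sup>2 - norm (A x)\<^sup>2)\<close> for \<open>N = norm A\<close>.\<close>

lemma Sp_nonempty:
  fixes A :: "'h::{real_inner,complete_space} \<Rightarrow>\<^sub>L 'h"
  assumes "self_adjoint A" and nontriv: "\<exists>x::'h. x \<noteq> 0"
  shows "Sp A \<noteq> {}"
proof
  assume empty: "Sp A = {}"
  define N where "N = norm A"
  have bel: "\<exists>K>0. \<forall>x. norm x \<le> K * norm (A x - z *\<^sub>R x)" for z
  proof -
    obtain K where "K > 0" and K: "\<And>y. norm (inv (\<lambda>x. A x - z *\<^sub>R x) y) \<le> K * norm y"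
      using self_adjoint_resolvent_bounded[OF assms(1)] empty by blast
    moreover have "inj (\<lambda>x. A x - z *\<^sub>R x)" using empty by (auto simp: Sp_def bij_def)
    ultimately show ?thesis by (metis inv_f_f)
  qed
  obtain K1 where K1: "K1 > 0" "\<And>x. norm x \<le> K1 * norm (A x - N *\<^sub>R x)" using bel by blast
  obtain K2 where K2: "K2 > 0" "\<And>x. norm x \<le> K2 * norm (A x - (- N) *\<^sub>R x)" using bel by blast
  define C where "C = (K1 * K2)\<^sup>2"
  have C: "C > 0" using K1 K2 by (simp add: C_def)
  have main: "(norm x)\<^sup>2 \<le> C * (N\<^sup>2 * (N\<^sup>2 * (norm x)\<^sup>2 - (norm (A x))\<^sup>2))" for x
  proof -
    let ?v = "A (A x) - N\<^sup>2 *\<^sub>R x"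
    have "norm x \<le> K1 * norm (A x - N *\<^sub>R x)" by (rule K1)
    \<comment> \<open>The two bounds are chained through the factorization
      \<open>A^2 - N^2 = (A + N) (A - N)\<close>.\<close>
    also have "\<dots> \<le> K1 * (K2 * norm ?v)"
      using K2(2)[of "A x - N *\<^sub>R x"] K1(1)
      by (intro mult_left_mono) (auto simp: blinfun.diff_right blinfun.scaleR_right power2_eq_square scaleR_diff_right)
    finally have "(norm x)\<^sup>2 \<le> (K1 * K2 * norm ?v)\<^sup>2"
      by (intro power_mono) (auto simp: mult.assoc)
    also have "\<dots> = C * (norm ?v)\<^sup>2" by (simp add: C_def power_mult_distrib)
    also have "(norm ?v)\<^sup>2 \<le> N\<^sup>2 * (N\<^sup>2 * (norm x)\<^sup>2 - (norm (A x))\<^sup>2)"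
    proof -
      have "A (A x) \<bullet> x = (norm (A x))\<^sup>2"
        using assms(1) by (simp add: self_adjoint_def power2_norm_eq_inner)
      then have "(norm ?v)\<^sup>2 = (norm (A (A x)))\<^sup>2 - 2 * N\<^sup>2 * (norm (A x))\<^sup>2 + N\<^sup>2 * N\<^sup>2 * (norm x)\<^sup>2"
        unfolding power2_norm_eq_inner
        by (simp add: inner_diff_left inner_diff_right inner_commute algebra_simps power2_eq_square)
      moreover have "(norm (A (A x)))\<^sup>2 \<le> (N * norm (A x))\<^sup>2"
        unfolding N_def by (intro power_mono norm_blinfun) auto
      ultimately show ?thesis by (simp add: power_mult_distrib algebra_simps)
    qed
    finally show ?thesis using C by simp
  qed
  obtain u :: 'h where u: "u \<noteq> 0" using nontriv by blast
  \<comment> \<open>For \<open>N = 0\<close> the bound \<open>main\<close> would force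
    \<open>u = 0\<close>.\<close>
  have "N \<noteq> 0" using main[of u] u by auto
  then have N: "N > 0" unfolding N_def by simp
  \<comment> \<open>This is \<open>main\<close> solved for the square of \<open>norm (A x)\<close>.
    Since \<open>b < N^2\<close>, \<open>sqrt b\<close> would be an operator bound below the
    operator norm.\<close>
  define b where "b = N\<^sup>2 - 1 / (C * N\<^sup>2)"
  have Ab: "(norm (A x))\<^sup>2 \<le> b * (norm x)\<^sup>2" for x
    using main[of x] N C by (simp add: b_def field_simps)
  have "0 \<le> b * (norm u)\<^sup>2" using Ab[of u] by (meson order_trans zero_le_power2)
  then have "b \<ge> 0" using u by (simp add: zero_le_mult_iff)
  have "norm (A x) \<le> sqrt b * norm x" for x
    using Ab[of x] real_sqrt_le_mono[OF Ab[of x]] by (simp add: real_sqrt_mult)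
  then have "N \<le> sqrt b" unfolding N_def using \<open>b \<ge> 0\<close> by (intro norm_blinfun_bound) auto
  then have "N\<^sup>2 \<le> b" using N \<open>b \<ge> 0\<close> using power_mono[of N "sqrt b" 2] by simp
  moreover have "1 / (C * N\<^sup>2) > 0" using N C by simp
  ultimately show False by (simp add: b_def)
qed

subsection \<open>Certificates\<close>

text \<open>If every member of \<open>W\<close> meets a set, then one member contained in
  \<open>U\<close> proves that \<open>U\<close> meets that set.\<close>

definition detects :: "real set set \<Rightarrow> real set \<Rightarrow> bool" where
  "detects W U \<longleftrightarrow> (\<exists>B\<in>W. B \<subseteq> U)"

lemma detects_mono: "W \<subseteq> W' \<Longrightarrow> detects W U \<Longrightarrow> detects W' U"
  by (auto simp: detects_def)

text \<open>The algorithms below use the evaluations only through the finite set \<open>obs n A\<close> of closed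
intervals certified at stage \<open>n\<close> to meet the spectrum.\<close>

locale spectral_observation =
  fixes Om :: "'a set" and Lam :: "('a \<Rightarrow> complex) set" and Spec :: "'a \<Rightarrow> real set"
    and obs :: "nat \<Rightarrow> 'a \<Rightarrow> real set set"
  assumes compact_Spec: "A \<in> Om \<Longrightarrow> compact (Spec A)"
    and Spec_nonempty: "A \<in> Om \<Longrightarrow> Spec A \<noteq> {}"
    and arith_alg_obs: "arith_alg Om Lam (\<lambda>A. real_of_rat (g (obs n A)))"
    and obs_Suc: "obs n A \<subseteq> obs (Suc n) A"
    and obs_sound: "A \<in> Om \<Longrightarrow> B \<in> obs n A \<Longrightarrow> B \<inter> Spec A \<noteq> {}"
    and obs_complete: "A \<in> Om \<Longrightarrow> open U \<Longrightarrow> U \<inter> Spec A \<noteq> {} \<Longrightarrow> \<exists>n. detects (obs n A) U"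
begin

lemma obs_mono: "m \<le> n \<Longrightarrow> obs m A \<subseteq> obs n A"
  by (rule lift_Suc_mono_le[of "\<lambda>n. obs n A"]) (rule obs_Suc)

lemma detects_sound: "A \<in> Om \<Longrightarrow> detects (obs n A) U \<Longrightarrow> U \<inter> Spec A \<noteq> {}"
  using obs_sound by (fastforce simp: detects_def)

text \<open>Soundness excludes false detections, and growth of \<open>obs\<close> preserves true
  ones, so the answer changes at most once.\<close>

lemma eventually_detects_iff:
  assumes "A \<in> Om" "open U"
  shows "\<forall>\<^sub>F n in sequentially. detects (obs n A) U \<longleftrightarrow> U \<inter> Spec A \<noteq> {}"
proof (cases "U \<inter> Spec A = {}")
  case True
  then have "\<not> detects (obs n A) U" for n using detects_sound[OF assms(1)] by blast
  then show ?thesis using True by simp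
next
  case False
  then obtain n where "detects (obs n A) U" using obs_complete assms by blast
  then have "detects (obs m A) U" if "m \<ge> n" for m using detects_mono obs_mono that by blast
  then show ?thesis using False by (auto simp: eventually_sequentially)
qed

end

text \<open>A triple \<open>(j, z, s)\<close> passes when \<open>G j z A + (1/2)^j \<le> s\<close>.
  The left side bounds the distance from \<open>z\<close> to the spectrum from above and converges
  to it in \<open>j\<close>, which gives soundness and completeness. Stage \<open>n\<close> tries
  the triples numbered up to \<open>n\<close>.\<close>

lemma spectral_observation_exists:
  assumes S2: "assumption_S2 Om Lam Spec"
    and cpt: "\<And>A. A \<in> Om \<Longrightarrow> compact (Spec A)" and ne: "\<And>A. A \<in> Om \<Longrightarrow> Spec A \<noteq> {}"
  shows "\<exists>obs. spectral_observation Om Lam Spec obs"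
proof -
  obtain Phi where approx: "\<And>n z m. \<exists>G. arith_alg Om Lam G \<and> (\<forall>A\<in>Om. \<bar>G A - Phi n z A\<bar> \<le> (1/2)^m)"
    and above: "\<And>n z A. A \<in> Om \<Longrightarrow> infdist z (Spec A) \<le> Phi n z A"
    and lim: "\<And>A K. A \<in> Om \<Longrightarrow> compact K \<Longrightarrow>
      uniform_limit K (\<lambda>n z. Phi n z A) (\<lambda>z. infdist z (Spec A)) sequentially"
    using S2 unfolding assumption_S2_def by metis
  obtain G where G: "\<And>j z. arith_alg Om Lam (G j z)"
    and G_Phi: "\<And>j z A. A \<in> Om \<Longrightarrow> \<bar>G j z A - Phi j z A\<bar> \<le> (1/2)^j"
  proof -
    \<comment> \<open>Coupling the accuracy to the index \<open>j\<close> makes the computational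
      error vanish in the limit.\<close>
    have "\<forall>j z. \<exists>G. arith_alg Om Lam G \<and> (\<forall>A\<in>Om. \<bar>G A - Phi j z A\<bar> \<le> (1/2)^j)"
      using approx by blast
    then obtain G where "\<forall>j z. arith_alg Om Lam (G j z) \<and> (\<forall>A\<in>Om. \<bar>G j z A - Phi j z A\<bar> \<le> (1/2)^j)"
      unfolding choice_iff by blast
    then show ?thesis using that[of G] by blast
  qed
  have G_above: "infdist z (Spec A) \<le> G j z A + (1/2)^j" if "A \<in> Om" for A j z
    using G_Phi[OF that, of j z] above[OF that, of z j] by linarith
  have G_lim: "(\<lambda>j. G j z A + (1/2)^j) \<longlonglongrightarrow> infdist z (Spec A)" if "A \<in> Om" for A z
  proof -
    have half: "(\<lambda>j. (1/2::real)^j) \<longlonglongrightarrow> 0" by (rule LIMSEQ_realpow_zero) auto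
    have "(\<lambda>j. G j z A - Phi j z A) \<longlonglongrightarrow> 0"
      by (rule Lim_null_comparison[OF _ half]) (use G_Phi[OF that] in auto)
    moreover have "(\<lambda>j. Phi j z A) \<longlonglongrightarrow> infdist z (Spec A)"
      using tendsto_uniform_limitI[OF lim[OF that compact_sing, of z]] by simp
    ultimately have "(\<lambda>j. (G j z A - Phi j z A) + Phi j z A + (1/2)^j) \<longlonglongrightarrow> 0 + infdist z (Spec A) + 0"
      by (intro tendsto_add half)
    then show ?thesis by simp
  qed
  define test :: "nat \<times> rat \<times> rat \<Rightarrow> 'a \<Rightarrow> real" where "test = (\<lambda>(j, z, s). G j (of_rat z))"
  \<comment> \<open>The error term is moved to the right because a test compares a computed value
    with a fixed rational.\<close>
  define bound :: "nat \<times> rat \<times> rat \<Rightarrow> rat" where "bound = (\<lambda>(j, z, s). s - (1/2)^j)"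
  define ivl :: "nat \<times> rat \<times> rat \<Rightarrow> real set" where "ivl = (\<lambda>(j, z, s). cball (of_rat z) (of_rat s))"
  define obs where "obs n A = ivl ` {i \<in> from_nat ` {..n}. test i A \<le> of_rat (bound i)}" for n A
  have passes: "test (j, z, s) A \<le> of_rat (bound (j, z, s)) \<longleftrightarrow> G j (of_rat z) A + (1/2)^j \<le> of_rat s"
    for j z s A by (auto simp: test_def bound_def of_rat_diff of_rat_power of_rat_divide)
  show ?thesis
  proof (intro exI[of _ obs] spectral_observation.intro)
    fix n and g :: "real set set \<Rightarrow> rat"
    have "arith_alg Om Lam (test i)" for i by (cases i) (simp add: test_def G)
    then show "arith_alg Om Lam (\<lambda>A. real_of_rat (g (obs n A)))"
      unfolding obs_def using arith_alg_finite_tests[of "from_nat ` {..n}" Om Lam test "\<lambda>S. g (ivl ` S)" bound]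
      by simp
  next
    show "obs n A \<subseteq> obs (Suc n) A" for n A unfolding obs_def by (auto simp: le_Suc_eq)
  next
    fix A B n assume A: "A \<in> Om" and "B \<in> obs n A"
    then obtain i where i: "B = ivl i" "test i A \<le> of_rat (bound i)"
      unfolding obs_def by blast
    obtain j z s where "i = (j, z, s)" by (cases i)
    then have B: "B = cball (of_rat z) (of_rat s)"
      and le: "G j (of_rat z) A + (1/2)^j \<le> of_rat s"
      using i passes by (auto simp: ivl_def)
    \<comment> \<open>The spectrum is closed, so the distance is attained, and the nearest point
      lies in the closed interval.\<close>
    obtain x where "x \<in> Spec A" "infdist (of_rat z) (Spec A) = dist (of_rat z) x"
      using infdist_attains_inf[OF compact_imp_closed[OF cpt[OF A]] ne[OF A]] by metis
    then show "B \<inter> Spec A \<noteq> {}" using G_above[OF A, of "of_rat z" j] le B by auto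
  next
    fix A U assume A: "A \<in> Om" and "open U" "U \<inter> Spec A \<noteq> {}"
    then obtain x e where x: "x \<in> U" "x \<in> Spec A" and e: "e > 0" "ball x e \<subseteq> U"
      by (metis disjoint_iff openE)
    \<comment> \<open>With \<open>z\<close> within \<open>e/4\<close> of \<open>x\<close> and
      \<open>s\<close> between \<open>e/4\<close> and \<open>e/2\<close>, the distance is below
      \<open>s\<close>, yet the interval stays within \<open>3e/4\<close> of
      \<open>x\<close>.\<close>
    obtain z :: rat where z: "x - e/4 < of_rat z" "of_rat z < x"
      using of_rat_dense[of "x - e/4" x] e by auto
    obtain s :: rat where s: "e/4 < of_rat s" "of_rat s < e/2"
      using of_rat_dense[of "e/4" "e/2"] e by auto
    have "infdist (of_rat z) (Spec A) \<le> dist (of_rat z) x" by (rule infdist_le[OF x(2)])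
    also have "\<dots> < of_rat s" using z s by (simp add: dist_real_def)
    finally have "infdist (of_rat z) (Spec A) < of_rat s" .
    then have "\<forall>\<^sub>F j in sequentially. G j (of_rat z) A + (1/2)^j < of_rat s"
      using order_tendstoD(2)[OF G_lim[OF A]] by blast
    then obtain j where "G j (of_rat z) A + (1/2)^j < of_rat s"
      using eventually_happens'[OF sequentially_bot] by blast
    then have "ivl (j, z, s) \<in> obs (to_nat (j, z, s)) A"
      unfolding obs_def using passes by (intro imageI CollectI conjI image_eqI[of _ _ "to_nat (j, z, s)"]) auto
    moreover have "ivl (j, z, s) \<subseteq> U"
    proof -
      have "cball (real_of_rat z) (of_rat s) \<subseteq> ball x e"
        using z s by (auto simp: dist_real_def)
      then show ?thesis using e by (auto simp: ivl_def)
    qed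
    ultimately show "\<exists>n. detects (obs n A) U" unfolding detects_def by blast
  qed (use cpt ne in auto)
qed

subsection \<open>Box-counting dimensions\<close>

text \<open>The dyadic interval \<open>m\<close> of length \<open>2\<^sup>-\<^sup>k\<close>, fattened to an open set so that meeting it is detectable;
this changes the box count at most by a factor of 3.\<close>

definition fat_box :: "nat \<Rightarrow> int \<Rightarrow> real set" where
  "fat_box k m = {(of_int m - 1) * (1/2)^k <..< (of_int m + 2) * (1/2)^k}"

definition fat_count :: "nat \<Rightarrow> real set \<Rightarrow> nat" where
  "fat_count k F = card {m. fat_box k m \<inter> F \<noteq> {}}"

text \<open>The floor makes the rate a rational that a leaf can output, and the cap keeps it in the
  unit interval; both cost only O(1/k). For \<open>k = 0\<close> or \<open>c = 0\<close> the library
  conventions give 0.\<close>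

definition box_rate :: "nat \<Rightarrow> nat \<Rightarrow> rat" where
  "box_rate k c = min 1 (of_int \<lfloor>log 2 (real c)\<rfloor> / of_nat k)"

lemma of_rat_min: "real_of_rat (min a b) = min (of_rat a) (of_rat b)"
  by (simp add: min_def of_rat_less_eq)

lemma open_fat_box: "open (fat_box k m)"
  by (simp add: fat_box_def)

lemma box_rate_le_1: "box_rate k c \<le> 1"
  by (simp add: box_rate_def)

lemma log2_nat_nonneg: "0 \<le> log 2 (real c)"
  by (cases "c = 0") (auto simp: log_def)

lemma box_rate_nonneg: "0 \<le> box_rate k c"
  using log2_nat_nonneg[of c] by (simp add: box_rate_def)

lemma box_rate_mono: "c \<le> c' \<Longrightarrow> box_rate k c \<le> box_rate k c'"
proof (cases "c = 0")
  case True
  then show ?thesis using box_rate_nonneg[of k c'] by (simp add: box_rate_def log_def)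
next
  case False
  assume "c \<le> c'"
  then have "log 2 (real c) \<le> log 2 (real c')" using False by simp
  then have "\<lfloor>log 2 (real c)\<rfloor> \<le> \<lfloor>log 2 (real c')\<rfloor>" by (rule floor_mono)
  then have "rat_of_int \<lfloor>log 2 (real c)\<rfloor> / of_nat k \<le> of_int \<lfloor>log 2 (real c')\<rfloor> / of_nat k"
    by (intro divide_right_mono) auto
  then show ?thesis unfolding box_rate_def by (intro min.mono) auto
qed

lemma fat_box_subset:
  assumes "F \<subseteq> {-M..M}" "M \<ge> 0"
  shows "{m. fat_box k m \<inter> F \<noteq> {}} \<subseteq> {-\<lfloor>M * 2^k\<rfloor> - 2..\<lfloor>M * 2^k\<rfloor> + 1}"
proof
  fix m assume "m \<in> {m. fat_box k m \<inter> F \<noteq> {}}"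
  then obtain x where x: "x \<in> F" "(of_int m - 1) * (1/2)^k < x" "x < (of_int m + 2) * (1/2)^k"
    by (auto simp: fat_box_def)
  then have "of_int m - 1 < x * 2^k" "x * 2^k < of_int m + 2"
    by (auto simp: power_one_over field_simps)
  moreover have "x \<le> M" "- M \<le> x" using x assms by auto
  then have bds: "x * 2^k \<le> M * 2^k" "- M * 2^k \<le> x * 2^k" by (intro mult_right_mono; simp)+
  ultimately have "real_of_int (m - 1) \<le> M * 2^k" "real_of_int (- m - 2) \<le> M * 2^k"
    using bds unfolding of_int_diff of_int_minus of_int_1 of_int_numeral by linarith+
  then have "m - 1 \<le> \<lfloor>M * 2^k\<rfloor>" "- m - 2 \<le> \<lfloor>M * 2^k\<rfloor>" by (simp_all only: le_floor_iff)
  then show "m \<in> {-\<lfloor>M * 2^k\<rfloor> - 2..\<lfloor>M * 2^k\<rfloor> + 1}" by auto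
qed

lemma bounded_real_symE:
  fixes F :: "real set"
  assumes "bounded F"
  obtains M where "M \<ge> 0" "F \<subseteq> {-M..M}"
proof -
  obtain M where "\<And>x. x \<in> F \<Longrightarrow> \<bar>x\<bar> \<le> M" using assms by (auto simp: bounded_iff)
  then have "F \<subseteq> {-\<bar>M\<bar>..\<bar>M\<bar>}" by fastforce
  then show ?thesis using that[of "\<bar>M\<bar>"] by simp
qed

lemma finite_fat_boxes: "bounded F \<Longrightarrow> finite {m. fat_box k m \<inter> F \<noteq> {}}"
  by (erule bounded_real_symE) (blast intro: finite_subset[OF fat_box_subset])

lemma closed_box_subset_fat_box: "{of_int m * (1/2)^k .. (of_int m + 1) * (1/2)^k} \<subseteq> fat_box k m"
proof -
  have "(1/2 :: real)^k > 0" by simp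
  then show ?thesis unfolding fat_box_def distrib_right left_diff_distrib
    by (intro subsetI) (unfold atLeastAtMost_iff greaterThanLessThan_iff, linarith)
qed

lemma N_count_le_fat_count:
  assumes "bounded F"
  shows "N_count ((1/2)^k) F \<le> fat_count k F"
  unfolding N_count_def fat_count_def
  by (intro card_mono finite_fat_boxes assms Collect_mono impI)
    (use closed_box_subset_fat_box in blast)

text \<open>A point of the fat box \<open>m\<close> lies in one of the closed boxes
  \<open>m - 1\<close>, \<open>m\<close>, \<open>m + 1\<close>, so every fat box counted is a
  neighbour of a box counted.\<close>

lemma fat_count_le:
  assumes "bounded F"
  shows "fat_count k F \<le> 3 * N_count ((1/2)^k) F"
proof -
  let ?N = "{m::int. {of_int m * (1/2)^k .. (of_int m + 1) * (1/2)^k} \<inter> F \<noteq> {}}"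
  have "?N \<subseteq> {m. fat_box k m \<inter> F \<noteq> {}}" using closed_box_subset_fat_box by fast
  then have fin: "finite ?N" using finite_fat_boxes[OF assms] finite_subset by blast
  have "{m. fat_box k m \<inter> F \<noteq> {}} \<subseteq> (\<lambda>m. m + 1) ` ?N \<union> (?N \<union> (\<lambda>m. m - 1) ` ?N)"
  proof
    fix m assume "m \<in> {m. fat_box k m \<inter> F \<noteq> {}}"
    then obtain x where x: "x \<in> F" "(of_int m - 1) * (1/2)^k < x" "x < (of_int m + 2) * (1/2)^k"
      by (auto simp: fat_box_def)
    let ?I = "\<lambda>m::int. {of_int m * (1/2)^k .. (of_int m + 1) * (1/2)^k}"
    consider "x \<in> ?I (m - 1)" | "x \<in> ?I m" | "x \<in> ?I (m + 1)"
      using x unfolding atLeastAtMost_iff by (force simp: algebra_simps)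
    then show "m \<in> (\<lambda>m. m + 1) ` ?N \<union> (?N \<union> (\<lambda>m. m - 1) ` ?N)"
    proof cases
      case 1
      then have "m - 1 \<in> ?N" using x(1) by blast
      then show ?thesis by (intro UnI1 image_eqI[of _ _ "m - 1"]) auto
    next
      case 2
      then have "m \<in> ?N" using x(1) by blast
      then show ?thesis by blast
    next
      case 3
      then have "m + 1 \<in> ?N" using x(1) by blast
      then show ?thesis by (intro UnI2 image_eqI[of _ _ "m + 1"]) auto
    qed
  qed
  then have "fat_count k F \<le> card ((\<lambda>m. m + 1) ` ?N \<union> (?N \<union> (\<lambda>m. m - 1) ` ?N))"
    unfolding fat_count_def using fin by (intro card_mono) auto
  also have "\<dots> \<le> card ?N + (card ?N + card ?N)"
    by (intro order_trans[OF card_Un_le] add_mono card_image_le fin order_refl)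
  finally show ?thesis by (simp add: N_count_def)
qed

text \<open>The box with index \<open>\<lfloor>x * 2^k\<rfloor>\<close> contains \<open>x\<close>.
  Finiteness of the fat boxes makes their count positive, and the comparison transfers this to
  \<open>N_count\<close>.\<close>

lemma N_count_pos:
  assumes "bounded F" "F \<noteq> {}"
  shows "N_count ((1/2)^k) F > 0"
proof -
  obtain x where x: "x \<in> F" using assms by blast
  have "of_int \<lfloor>x * 2^k\<rfloor> \<le> x * 2^k" "x * 2^k \<le> of_int \<lfloor>x * 2^k\<rfloor> + 1" by linarith+
  then have "of_int \<lfloor>x * 2^k\<rfloor> * (1/2)^k \<le> x" "x \<le> (of_int \<lfloor>x * 2^k\<rfloor> + 1) * (1/2)^k"
    by (auto simp: power_one_over field_simps)
  then have "\<lfloor>x * 2^k\<rfloor> \<in> {m::int. fat_box k m \<inter> F \<noteq> {}}"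
    using x closed_box_subset_fat_box[of "\<lfloor>x * 2^k\<rfloor>" k] by auto
  then have "fat_count k F > 0"
    unfolding fat_count_def using finite_fat_boxes[OF assms(1)] by (metis card_gt_0_iff empty_iff)
  then show ?thesis using fat_count_le[OF assms(1), of k] by linarith
qed

text \<open>About \<open>2 * M * 2^k + 4\<close> boxes reach into \<open>{-M..M}\<close>. This shows
  that capping the rate at 1 loses at most \<open>C / k\<close>.\<close>

lemma log_fat_count_le:
  assumes "bounded F" "F \<noteq> {}"
  obtains C where "C \<ge> 0" "\<And>k. log 2 (fat_count k F) \<le> real k + C"
proof -
  obtain M where M: "M \<ge> 0" "F \<subseteq> {-M..M}" using assms bounded_real_symE by blast
  have "log 2 (fat_count k F) \<le> real k + log 2 (2 * M + 4)" for k
  proof -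
    have "fat_count k F \<le> card {-\<lfloor>M * 2^k\<rfloor> - 2..\<lfloor>M * 2^k\<rfloor> + 1}"
      unfolding fat_count_def by (intro card_mono fat_box_subset[OF M(2) M(1)]) auto
    also have "\<dots> = nat (2 * \<lfloor>M * 2^k\<rfloor> + 4)" by simp
    finally have "real (fat_count k F) \<le> 2 * of_int \<lfloor>M * 2^k\<rfloor> + 4"
      using M(1) by (simp add: le_nat_iff)
    also have "\<dots> \<le> 2 * (M * 2^k) + 4 * 2^k" by (intro add_mono) auto
    finally have "real (fat_count k F) \<le> 2^k * (2 * M + 4)" by (simp add: algebra_simps)
    moreover have "fat_count k F > 0"
      using N_count_pos[OF assms, of k] N_count_le_fat_count[OF assms(1), of k] by linarith
    ultimately have "log 2 (fat_count k F) \<le> log 2 (2^k * (2 * M + 4))" by simp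
    then show ?thesis using M(1) by (simp add: log_mult)
  qed
  then show ?thesis using M(1) that[of "log 2 (2 * M + 4)"] by simp
qed

lemma box_rate_fat_count_asymp:
  assumes "bounded F" "F \<noteq> {}"
  shows "(\<lambda>k. real_of_rat (box_rate k (fat_count k F)) - ln (real (N_count ((1/2)^k) F)) / ln (2^k))
           \<longlonglongrightarrow> 0"
proof -
  obtain C where C: "C \<ge> 0" "\<And>k. log 2 (fat_count k F) \<le> real k + C"
    using log_fat_count_le[OF assms] by blast
  have "norm (real_of_rat (box_rate k (fat_count k F)) - ln (real (N_count ((1/2)^k) F)) / ln (2^k))
          \<le> (C + 4) / real k" if "k > 0" for k
  proof -
    define N c where "N = N_count ((1/2)^k) F" and "c = fat_count k F"
    define f where "f = real_of_int \<lfloor>log 2 c\<rfloor>"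
    have N: "N > 0" "N \<le> c" "c \<le> 3 * N"
      using N_count_pos N_count_le_fat_count fat_count_le assms by (auto simp: N_def c_def)
    have "log 2 N \<le> log 2 c" using N by simp
    moreover have "log 2 c \<le> log 2 3 + log 2 N"
    proof -
      have "real c \<le> 3 * real N" using N(3) by linarith
      then have "log 2 c \<le> log 2 (3 * real N)" using N by simp
      then show ?thesis using N by (simp add: log_mult)
    qed
    moreover have "log 2 (3::real) \<le> 2"
      by (simp add: log_le_iff)
    \<comment> \<open>The floor loses less than 1 and the factor 3 in the count at most
      \<open>log 2 3 \<le> 2\<close>.\<close>
    ultimately have "\<bar>f - log 2 N\<bar> \<le> 3" unfolding f_def by linarith
    then have "\<bar>f / k - log 2 N / k\<bar> \<le> 3 / k"
      using that by (simp flip: diff_divide_distrib add: divide_right_mono)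
    moreover have "f / k \<le> 1 + C / k"
    proof -
      have "f \<le> k + C" using C(2)[of k] unfolding f_def c_def by linarith
      then show ?thesis using that by (simp add: field_simps)
    qed
    moreover have "real_of_rat (box_rate k c) = min 1 (f / k)"
      by (simp add: box_rate_def f_def of_rat_min of_rat_divide)
    moreover have "ln (real N) / ln (2^k) = log 2 N / k"
      by (simp add: log_def ln_realpow)
    moreover have "(C + 4) / real k = C / k + 4 / k" by (simp add: add_divide_distrib)
    moreover have "3 / real k \<le> 4 / k" "C / k \<ge> 0" using that C by (auto simp: divide_right_mono)
    ultimately show ?thesis unfolding N_def[symmetric] c_def[symmetric] real_norm_def by linarith
  qed
  then have "\<forall>\<^sub>F k in sequentially. norm (real_of_rat (box_rate k (fat_count k F))
      - ln (real (N_count ((1/2)^k) F)) / ln (2^k)) \<le> (C + 4) / real k"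
    using eventually_gt_at_top[of 0] by (rule eventually_mono[rotated])
  then show ?thesis by (rule Lim_null_comparison) (rule lim_const_over_n)
qed

section \<open>Suprema and infima over tails of a bounded sequence\<close>

lemma limsup_add_null:
  assumes "(\<lambda>k. d k - a k :: real) \<longlonglongrightarrow> 0"
  shows "limsup (\<lambda>k. ereal (d k)) = limsup (\<lambda>k. ereal (a k))"
    and "liminf (\<lambda>k. ereal (d k)) = liminf (\<lambda>k. ereal (a k))"
proof -
  have *: "(\<lambda>k. ereal (d k - a k)) \<longlonglongrightarrow> 0" using assms by (simp add: zero_ereal_def)
  have "ereal (d k) = ereal (d k - a k) + ereal (a k)" for k by simp
  then show "limsup (\<lambda>k. ereal (d k)) = limsup (\<lambda>k. ereal (a k))"
    and "liminf (\<lambda>k. ereal (d k)) = liminf (\<lambda>k. ereal (a k))"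
    using ereal_limsup_lim_add[OF *, of "\<lambda>k. ereal (a k)"]
      ereal_liminf_lim_add[OF *, of "\<lambda>k. ereal (a k)"] by simp_all
qed

text \<open>The tails take values in the unit interval, where suprema in \<open>ereal\<close> and in
  the reals agree, so the extended limsup is a limit of real suprema.\<close>

lemma real_SUP_tail_tendsto_limsup:
  fixes d :: "nat \<Rightarrow> real"
  assumes d: "\<And>k. d k \<in> {0..1}"
  shows "(\<lambda>n. SUP k\<in>{n..}. d k) \<longlonglongrightarrow> real_of_ereal (limsup (\<lambda>k. ereal (d k)))"
    and "decseq (\<lambda>n. SUP k\<in>{n..}. d k)"
proof -
  have bdd: "bdd_above (d ` S)" for S using d by (intro bdd_aboveI[of _ 1]) auto
  show "decseq (\<lambda>n. SUP k\<in>{n..}. d k)"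
    by (intro decseq_SucI cSUP_subset_mono bdd) auto
  have ub: "(SUP k\<in>{n..}. ereal (d k)) \<in> {0..1}" for n
    using d by (auto intro!: SUP_least SUP_upper2[of n] simp: zero_ereal_def one_ereal_def)
  then have "\<bar>SUP k\<in>{n..}. ereal (d k)\<bar> \<noteq> \<infinity>" for n by (cases "SUP k\<in>{n..}. ereal (d k)") (use ub[of n] in auto)
  then have eq: "ereal (SUP k\<in>{n..}. d k) = (SUP k\<in>{n..}. ereal (d k))" for n by (rule ereal_SUP)
  have "decseq (\<lambda>n. SUP k\<in>{n..}. ereal (d k))"
    by (intro decseq_SucI SUP_subset_mono) auto
  from LIMSEQ_INF[OF this] have lim: "(\<lambda>n. SUP k\<in>{n..}. ereal (d k)) \<longlonglongrightarrow> limsup (\<lambda>k. ereal (d k))"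
    by (simp add: limsup_INF_SUP)
  have "limsup (\<lambda>k. ereal (d k)) \<in> {0..1}"
    using ub by (intro closed_sequentially[OF _ _ lim]) auto
  then have "\<bar>limsup (\<lambda>k. ereal (d k))\<bar> \<noteq> \<infinity>" by (cases "limsup (\<lambda>k. ereal (d k))") auto
  then show "(\<lambda>n. SUP k\<in>{n..}. d k) \<longlonglongrightarrow> real_of_ereal (limsup (\<lambda>k. ereal (d k)))"
    using lim unfolding eq[symmetric] by (auto simp: ereal_real)
qed

lemma real_INF_tail_tendsto_liminf:
  fixes d :: "nat \<Rightarrow> real"
  assumes d: "\<And>k. d k \<in> {0..1}"
  shows "(\<lambda>n. INF k\<in>{n..}. d k) \<longlonglongrightarrow> real_of_ereal (liminf (\<lambda>k. ereal (d k)))"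
    and "incseq (\<lambda>n. INF k\<in>{n..}. d k)"
proof -
  have bdd: "bdd_below (d ` S)" for S using d by (intro bdd_belowI[of _ 0]) auto
  show "incseq (\<lambda>n. INF k\<in>{n..}. d k)"
    by (intro incseq_SucI cINF_superset_mono bdd) auto
  have ub: "(INF k\<in>{n..}. ereal (d k)) \<in> {0..1}" for n
    using d by (auto intro!: INF_greatest INF_lower2[of n] simp: zero_ereal_def one_ereal_def)
  then have "\<bar>INF k\<in>{n..}. ereal (d k)\<bar> \<noteq> \<infinity>" for n by (cases "INF k\<in>{n..}. ereal (d k)") (use ub[of n] in auto)
  then have eq: "ereal (INF k\<in>{n..}. d k) = (INF k\<in>{n..}. ereal (d k))" for n by (rule ereal_INF)
  have "incseq (\<lambda>n. INF k\<in>{n..}. ereal (d k))"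
    by (intro incseq_SucI INF_superset_mono) auto
  from LIMSEQ_SUP[OF this] have lim: "(\<lambda>n. INF k\<in>{n..}. ereal (d k)) \<longlonglongrightarrow> liminf (\<lambda>k. ereal (d k))"
    by (simp add: liminf_SUP_INF)
  have "liminf (\<lambda>k. ereal (d k)) \<in> {0..1}"
    using ub by (intro closed_sequentially[OF _ _ lim]) auto
  then have "\<bar>liminf (\<lambda>k. ereal (d k))\<bar> \<noteq> \<infinity>" by (cases "liminf (\<lambda>k. ereal (d k))") auto
  then show "(\<lambda>n. INF k\<in>{n..}. d k) \<longlonglongrightarrow> real_of_ereal (liminf (\<lambda>k. ereal (d k)))"
    using lim unfolding eq[symmetric] by (auto simp: ereal_real)
qed

lemma of_rat_Max:
  assumes "finite S" "S \<noteq> {}"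
  shows "real_of_rat (Max S) = Max (of_rat ` S)"
  by (intro mono_Max_commute assms monoI) (simp add: of_rat_less_eq)

lemma of_rat_Min:
  assumes "finite S" "S \<noteq> {}"
  shows "real_of_rat (Min S) = Min (of_rat ` S)"
  by (intro mono_Min_commute assms monoI) (simp add: of_rat_less_eq)

lemma of_rat_in_unit: "0 \<le> q \<Longrightarrow> q \<le> 1 \<Longrightarrow> real_of_rat q \<in> {0..1}"
  by (simp add: of_rat_le_1_iff)

text \<open>For \<open>y\<close> below the supremum, a single index with \<open>d k > y\<close>
  pushes the maximum past \<open>y\<close> once it is in range and exact; \<open>e \<le> d\<close>
  prevents overshooting. Thus approximation and growth of the range share one limit.\<close>

lemma Max_tail_tendsto_SUP:
  fixes e :: "nat \<Rightarrow> nat \<Rightarrow> real"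
  assumes ev: "\<And>k. \<forall>\<^sub>F n in sequentially. e n k = d k"
    and le: "\<And>n k. e n k \<le> d k" and bdd: "bdd_above (range d)"
  shows "(\<lambda>n. Max (e n ` {m..m + n})) \<longlonglongrightarrow> (SUP k\<in>{m..}. d k)"
proof (rule order_tendstoI)
  have bdd': "bdd_above (d ` {m..})" using bdd by (rule bdd_above_mono) auto
  fix y
  {
    assume "y < (SUP k\<in>{m..}. d k)"
    then obtain k where k: "k \<ge> m" "y < d k" using less_cSUP_iff[OF _ bdd'] by auto
    have "\<forall>\<^sub>F n in sequentially. e n k = d k \<and> k \<le> m + n"
      using ev eventually_ge_at_top[of k] by (rule eventually_elim2) auto
    then show "\<forall>\<^sub>F n in sequentially. y < Max (e n ` {m..m + n})"
    proof (rule eventually_mono)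
      fix n assume n: "e n k = d k \<and> k \<le> m + n"
      then have "e n k \<le> Max (e n ` {m..m + n})" using k by (intro Max_ge imageI) auto
      then show "y < Max (e n ` {m..m + n})" using n k by linarith
    qed
  next
    assume y: "(SUP k\<in>{m..}. d k) < y"
    have "Max (e n ` {m..m + n}) < y" for n
    proof -
      have "e n k < y" if "k \<in> {m..m + n}" for k
        using le[of n k] cSUP_upper[OF _ bdd', of k] that y by force
      then show ?thesis by (subst Max_less_iff) auto
    qed
    then show "\<forall>\<^sub>F n in sequentially. Max (e n ` {m..m + n}) < y" by (intro always_eventually allI)
  }
qed

text \<open>The exact \<open>d\<close> appears here: approximations from below could drag the
  minimum down at late indices, so the infimum gets a limit of its own.\<close>

lemma Min_tail_tendsto_INF:
  fixes d :: "nat \<Rightarrow> real"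
  assumes bdd: "bdd_below (range d)"
  shows "(\<lambda>n. Min (d ` {m..m + n})) \<longlonglongrightarrow> (INF k\<in>{m..}. d k)"
proof (rule order_tendstoI)
  have bdd': "bdd_below (d ` {m..})" using bdd by (rule bdd_below_mono) auto
  fix y
  {
    assume "(INF k\<in>{m..}. d k) < y"
    then obtain k where k: "k \<ge> m" "d k < y" using cINF_less_iff[OF _ bdd'] by auto
    have "Min (d ` {m..m + n}) < y" if "n \<ge> k" for n
    proof -
      have "Min (d ` {m..m + n}) \<le> d k" using k that by (intro Min_le) auto
      then show ?thesis using k by linarith
    qed
    then show "\<forall>\<^sub>F n in sequentially. Min (d ` {m..m + n}) < y"
      by (rule eventually_sequentiallyI)
  next
    assume y: "y < (INF k\<in>{m..}. d k)"
    have "y < Min (d ` {m..m + n})" for n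
    proof -
      have "y < d k" if "k \<in> {m..m + n}" for k
        using cINF_lower[OF bdd', of k] that y by force
      then show ?thesis by (subst Min_gr_iff) auto
    qed
    then show "\<forall>\<^sub>F n in sequentially. y < Min (d ` {m..m + n})" by (intro always_eventually allI)
  }
qed

lemma eventually_Collect_eq:
  assumes "finite I" "\<And>i. i \<in> I \<Longrightarrow> \<forall>\<^sub>F n in F. P n i \<longleftrightarrow> Q i"
  shows "\<forall>\<^sub>F n in F. {i\<in>I. P n i} = {i\<in>I. Q i}"
proof -
  have "\<forall>\<^sub>F n in F. \<forall>i\<in>I. P n i \<longleftrightarrow> Q i" by (rule eventually_ball_finite) (use assms in auto)
  then show ?thesis by (rule eventually_mono) auto
qed

lemma tendsto_fun_eventually_eq:
  assumes "\<forall>\<^sub>F n in F. S n = T"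
  shows "((\<lambda>n. f (S n)) \<longlongrightarrow> f T) F"
  by (rule tendsto_eventually) (use assms in \<open>auto elim: eventually_mono\<close>)

section \<open>Towers for the box-counting dimensions\<close>

context spectral_observation
begin

definition seen_count :: "nat \<Rightarrow> nat \<Rightarrow> 'a \<Rightarrow> nat" where
  "seen_count n k A = card {m. detects (obs n A) (fat_box k m)}"

definition seen_rate :: "nat \<Rightarrow> 'a \<Rightarrow> nat \<Rightarrow> real" where
  "seen_rate n A k = of_rat (box_rate k (seen_count n k A))"

definition true_rate :: "'a \<Rightarrow> nat \<Rightarrow> real" where
  "true_rate A k = of_rat (box_rate k (fat_count k (Spec A)))"

lemma bounded_Spec: "A \<in> Om \<Longrightarrow> bounded (Spec A)"
  using compact_Spec compact_imp_bounded by blast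

lemma seen_count_le: "A \<in> Om \<Longrightarrow> seen_count n k A \<le> fat_count k (Spec A)"
  unfolding seen_count_def fat_count_def
  by (intro card_mono finite_fat_boxes bounded_Spec Collect_mono impI detects_sound)

text \<open>Boxes missing the spectrum are never detected, and the finitely many others are all
  detected from some stage on.\<close>

lemma eventually_seen_count:
  assumes "A \<in> Om"
  shows "\<forall>\<^sub>F n in sequentially. seen_count n k A = fat_count k (Spec A)"
proof -
  let ?M = "{m. fat_box k m \<inter> Spec A \<noteq> {}}"
  have "finite ?M" using finite_fat_boxes bounded_Spec assms by blast
  then have "\<forall>\<^sub>F n in sequentially. {m\<in>?M. detects (obs n A) (fat_box k m)} = {m\<in>?M. fat_box k m \<inter> Spec A \<noteq> {}}"
    by (rule eventually_Collect_eq) (rule eventually_detects_iff[OF assms open_fat_box])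
  then show ?thesis
  proof (rule eventually_mono)
    fix n assume *: "{m\<in>?M. detects (obs n A) (fat_box k m)} = {m\<in>?M. fat_box k m \<inter> Spec A \<noteq> {}}"
    have "{m. detects (obs n A) (fat_box k m)} = {m\<in>?M. detects (obs n A) (fat_box k m)}"
      using detects_sound[OF assms] by blast
    also have "\<dots> = ?M" unfolding * by blast
    finally show "seen_count n k A = fat_count k (Spec A)"
      by (simp add: seen_count_def fat_count_def)
  qed
qed

lemma eventually_seen_rate:
  "A \<in> Om \<Longrightarrow> \<forall>\<^sub>F n in sequentially. seen_rate n A k = true_rate A k"
  unfolding seen_rate_def true_rate_def
  by (drule eventually_seen_count[of _ k]) (auto elim: eventually_mono)

lemma seen_rate_le: "A \<in> Om \<Longrightarrow> seen_rate n A k \<le> true_rate A k"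
  unfolding seen_rate_def true_rate_def of_rat_less_eq by (intro box_rate_mono seen_count_le)

lemma true_rate_unit: "true_rate A k \<in> {0..1}"
  unfolding true_rate_def by (intro of_rat_in_unit box_rate_nonneg box_rate_le_1)

lemma true_rate_asymp:
  "A \<in> Om \<Longrightarrow>
    (\<lambda>k. true_rate A k - ln (real (N_count ((1/2)^k) (Spec A))) / ln (2^k)) \<longlonglongrightarrow> 0"
  unfolding true_rate_def by (intro box_rate_fat_count_asymp bounded_Spec Spec_nonempty)

text \<open>The index \<open>n1\<close> is both the observation stage and the length of the range.
  Missing observations only lower the rates, so one limit gives the tail suprema, which decrease to
  the dimension.\<close>

theorem upper_box_dim_Pi2: "Pi2_A Om Lam (\<lambda>A. upper_box_dim (Spec A))"
  unfolding Pi2_A_def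
proof (intro exI conjI allI ballI)
  let ?g = "\<lambda>n2 n1 W. Max ((\<lambda>k. box_rate k (card {m. detects W (fat_box k m)})) ` {n2..n2 + n1})"
  let ?G = "\<lambda>n2 n1 A. real_of_rat (?g n2 n1 (obs n1 A))"
  let ?G2 = "\<lambda>n2 A. SUP k\<in>{n2..}. true_rate A k"
  show "arith_alg Om Lam (?G n2 n1)" for n2 n1 by (rule arith_alg_obs)
  show "?G n2 n1 A \<in> {0..1}" for n2 n1 A
    by (intro of_rat_in_unit)
      (auto simp: Max_le_iff Max_ge_iff box_rate_le_1 box_rate_nonneg)
  fix A assume A: "A \<in> Om"
  have eq: "?G n2 n1 A = Max (seen_rate n1 A ` {n2..n2 + n1})" for n2 n1
    by (subst of_rat_Max) (auto simp: image_image seen_rate_def seen_count_def)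
  show "(\<lambda>n1. ?G n2 n1 A) \<longlonglongrightarrow> ?G2 n2 A" for n2
    unfolding eq using true_rate_unit[of A]
    by (intro Max_tail_tendsto_SUP eventually_seen_rate seen_rate_le A bdd_aboveI[of _ 1]) auto
  show "(\<lambda>n2. ?G2 n2 A) \<longlonglongrightarrow> upper_box_dim (Spec A)"
    unfolding upper_box_dim_def limsup_add_null(1)[OF true_rate_asymp[OF A], symmetric]
    by (rule real_SUP_tail_tendsto_limsup(1)[OF true_rate_unit])
  show "decseq (\<lambda>n2. ?G2 n2 A)" by (rule real_SUP_tail_tendsto_limsup(2)[OF true_rate_unit])
qed

text \<open>On a fixed range the rates are eventually exact; the second limit extends the range to
  the whole tail, and the tail infima increase to the dimension.\<close>

theorem lower_box_dim_Sigma3: "Sigma3_A Om Lam (\<lambda>A. lower_box_dim (Spec A))"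
  unfolding Sigma3_A_def
proof (intro exI conjI allI ballI)
  let ?g = "\<lambda>n3 n2 W. Min ((\<lambda>k. box_rate k (card {m. detects W (fat_box k m)})) ` {n3..n3 + n2})"
  let ?G = "\<lambda>n3 n2 n1 A. real_of_rat (?g n3 n2 (obs n1 A))"
  let ?G2 = "\<lambda>n3 n2 A. Min (true_rate A ` {n3..n3 + n2})"
  let ?G3 = "\<lambda>n3 A. INF k\<in>{n3..}. true_rate A k"
  show "arith_alg Om Lam (?G n3 n2 n1)" for n3 n2 n1 by (rule arith_alg_obs)
  show "?G n3 n2 n1 A \<in> {0..1}" for n3 n2 n1 A
    by (intro of_rat_in_unit)
      (auto simp: Min_le_iff Min_ge_iff box_rate_le_1 box_rate_nonneg)
  fix A assume A: "A \<in> Om"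
  have eq: "?G n3 n2 n1 A = Min (seen_rate n1 A ` {n3..n3 + n2})" for n3 n2 n1
    by (subst of_rat_Min) (auto simp: image_image seen_rate_def seen_count_def)
  show "(\<lambda>n1. ?G n3 n2 n1 A) \<longlonglongrightarrow> ?G2 n3 n2 A" for n3 n2
  proof -
    have "\<forall>\<^sub>F n1 in sequentially. \<forall>k\<in>{n3..n3 + n2}. seen_rate n1 A k = true_rate A k"
      using A eventually_seen_rate by (intro eventually_ball_finite) auto
    then have "\<forall>\<^sub>F n1 in sequentially. seen_rate n1 A ` {n3..n3 + n2} = true_rate A ` {n3..n3 + n2}"
      by (rule eventually_mono) (rule image_cong, auto)
    then show ?thesis unfolding eq by (rule tendsto_fun_eventually_eq)
  qed
  show "(\<lambda>n2. ?G2 n3 n2 A) \<longlonglongrightarrow> ?G3 n3 A" for n3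
    using true_rate_unit[of A] by (intro Min_tail_tendsto_INF bdd_belowI[of _ 0]) auto
  show "(\<lambda>n3. ?G3 n3 A) \<longlonglongrightarrow> lower_box_dim (Spec A)"
    unfolding lower_box_dim_def limsup_add_null(2)[OF true_rate_asymp[OF A], symmetric]
    by (rule real_INF_tail_tendsto_liminf(1)[OF true_rate_unit])
  show "incseq (\<lambda>n3. ?G3 n3 A)" by (rule real_INF_tail_tendsto_liminf(2)[OF true_rate_unit])
qed

end

lemma Pi2_A_subset_cong:
  assumes "Pi2_A Om Lam Xi" "Om' \<subseteq> Om" "\<And>A. A \<in> Om' \<Longrightarrow> Xi' A = Xi A"
  shows "Pi2_A Om' Lam Xi'"
proof -
  obtain G G2 where G: "\<And>n2 n1. arith_alg Om Lam (G n2 n1)"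
    "\<And>n2 n1 A. A \<in> Om \<Longrightarrow> G n2 n1 A \<in> {0..1}"
    "\<And>A n2. A \<in> Om \<Longrightarrow> (\<lambda>n1. G n2 n1 A) \<longlonglongrightarrow> G2 n2 A"
    "\<And>A. A \<in> Om \<Longrightarrow> (\<lambda>n2. G2 n2 A) \<longlonglongrightarrow> Xi A"
    "\<And>A. A \<in> Om \<Longrightarrow> decseq (\<lambda>n2. G2 n2 A)"
    using assms(1) unfolding Pi2_A_def by blast
  have "arith_alg Om' Lam (G n2 n1)" for n2 n1
    using G(1)[of n2 n1] assms(2) unfolding arith_alg_def by blast
  then show ?thesis unfolding Pi2_A_def using G assms(2,3)
    by (intro exI[of _ G] exI[of _ G2]) (simp add: subset_iff)
qed

subsection \<open>Hausdorff dimension\<close>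

text \<open>Lists of rational pairs form a countable type, so \<open>from_nat\<close> enumerates all
  these covers.\<close>

definition cover :: "(rat \<times> rat) list \<Rightarrow> real set" where
  "cover c = (\<Union>(a, b)\<in>set c. {of_rat a..of_rat b})"

text \<open>Reversed endpoints give an empty interval of diameter 0, which adds
  \<open>0 powr s = 0\<close>.\<close>

definition weight :: "real \<Rightarrow> (rat \<times> rat) list \<Rightarrow> real" where
  "weight s c = (\<Sum>(a, b)\<leftarrow>c. diameter {real_of_rat a..of_rat b} powr s)"

text \<open>For \<open>s > 0\<close> a small total weight forces every interval to be short, so
  \<open>\<epsilon>\<close> alone replaces the scale limit of the Hausdorff measure.\<close>

definition null_content :: "real \<Rightarrow> real set \<Rightarrow> bool" where
  "null_content s F \<longleftrightarrow> (\<forall>\<epsilon>>0. \<exists>c. F \<subseteq> cover c \<and> weight s c < \<epsilon>)"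

lemma closed_cover: "closed (cover c)"
  unfolding cover_def by (intro closed_UN) (auto simp: case_prod_beta)

lemma mem_cover: "(a, b) \<in> set c \<Longrightarrow> x \<in> {of_rat a..of_rat b} \<Longrightarrow> x \<in> cover c"
  unfolding cover_def by (rule UN_I[of "(a, b)"]) auto

lemma diameter_powr_le_weight:
  assumes "(a, b) \<in> set c"
  shows "diameter {real_of_rat a..of_rat b} powr s \<le> weight s c"
proof -
  have "diameter {real_of_rat a..of_rat b} powr s \<in>
      set (map (\<lambda>(a, b). diameter {real_of_rat a..of_rat b} powr s) c)"
    using assms by force
  then show ?thesis unfolding weight_def by (rule member_le_sum_list) auto
qed

lemma diameter_le_of_weight_less:
  assumes "(a, b) \<in> set c" "weight s c < \<delta> powr s" "s > 0" "\<delta> > 0"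
  shows "diameter {real_of_rat a..of_rat b} \<le> \<delta>"
proof (rule ccontr)
  assume "\<not> ?thesis"
  then have "\<delta> powr s \<le> diameter {real_of_rat a..of_rat b} powr s"
    using assms by (intro powr_mono2) auto
  then show False using diameter_powr_le_weight[OF assms(1), of s] assms(2) by linarith
qed

text \<open>A cover of \<open>t\<close>-weight below 1 has only diameters at most 1, and for these a
  larger exponent gives a smaller power.\<close>

lemma null_content_mono:
  assumes "null_content t F" "0 < t" "t \<le> s"
  shows "null_content s F"
  unfolding null_content_def
proof (intro allI impI)
  fix \<epsilon> :: real assume "\<epsilon> > 0"
  then obtain c where c: "F \<subseteq> cover c" "weight t c < min \<epsilon> 1"
    using assms(1) unfolding null_content_def by (metis min_less_iff_conj zero_less_one)
  have "weight s c \<le> weight t c"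
    unfolding weight_def
  proof (intro sum_list_mono, clarify)
    fix a b assume "(a, b) \<in> set c"
    then have "diameter {real_of_rat a..of_rat b} \<le> 1"
      using c(2) assms(2) by (intro diameter_le_of_weight_less[of a b c t]) auto
    then show "diameter {real_of_rat a..of_rat b} powr s \<le> diameter {real_of_rat a..of_rat b} powr t"
      using assms(3) by (intro powr_mono') (auto intro: diameter_ge_0)
  qed
  then show "\<exists>c. F \<subseteq> cover c \<and> weight s c < \<epsilon>" using c by auto
qed

lemma null_content_imp_hausdorff_measure_0:
  assumes null: "null_content s F" and s: "s > 0"
  shows "hausdorff_measure s F = 0"
proof -
  have "hausdorff_pre s \<delta> F \<le> 0" if \<delta>: "\<delta> > 0" for \<delta>
  proof (rule ennreal_le_epsilon)
    fix \<epsilon> :: real assume "\<epsilon> > 0"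
    then have "min \<epsilon> (\<delta> powr s) > 0" using \<delta> by simp
    then obtain c where c: "F \<subseteq> cover c" "weight s c < \<epsilon>" "weight s c < \<delta> powr s"
      using null unfolding null_content_def by (metis min_less_iff_conj)
    define J where "J i = {real_of_rat (fst (c ! i))..of_rat (snd (c ! i))}" for i
    \<comment> \<open>Padding with empty sets turns the list into the sequence that the Hausdorff
      measure requires, at no cost.\<close>
    define U where "U i = (if i < length c then J i else {})" for i
    have "F \<subseteq> (\<Union>i. U i)"
      using c(1) unfolding U_def J_def cover_def
      by (fastforce simp: in_set_conv_nth split: prod.splits)
    moreover have "bounded (U i) \<and> diameter (U i) \<le> \<delta>" for i
      using diameter_le_of_weight_less[OF _ c(3) s \<delta>, of "fst (c ! i)" "snd (c ! i)"] \<delta>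
      unfolding U_def J_def by auto
    ultimately have "hausdorff_pre s \<delta> F \<le> (\<Sum>i. ennreal (diameter (U i) powr s))"
      unfolding hausdorff_pre_def by (intro INF_lower) auto
    also have "\<dots> = (\<Sum>i<length c. ennreal (diameter (U i) powr s))"
      by (intro suminf_finite) (auto simp: U_def)
    also have "\<dots> = ennreal (\<Sum>i<length c. diameter (U i) powr s)" by (intro sum_ennreal) auto
    also have "(\<Sum>i<length c. diameter (U i) powr s) = weight s c"
      unfolding weight_def sum_list_sum_nth
      by (intro sum.cong) (auto simp: U_def J_def atLeast0LessThan case_prod_beta)
    also have "ennreal (weight s c) \<le> 0 + ennreal \<epsilon>" using c(2) by (simp add: ennreal_leI)
    finally show "hausdorff_pre s \<delta> F \<le> 0 + ennreal \<epsilon>" .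
  qed
  then have "hausdorff_measure s F \<le> 0" unfolding hausdorff_measure_def by (intro SUP_least) auto
  then show ?thesis by simp
qed

text \<open>The open interval serves the extraction of a finite subcover; its closure is what enters
  \<open>cover\<close>.\<close>

lemma enlarge_to_rational_interval:
  fixes U :: "real set"
  assumes U: "bounded U" and s: "s > 0" and \<eta>: "\<eta> > 0"
  shows "\<exists>a b. U \<subseteq> {real_of_rat a<..<of_rat b} \<and>
           diameter {real_of_rat a..of_rat b} powr s \<le> diameter U powr s + \<eta>"
proof (cases "U = {}")
  case True
  then show ?thesis using \<eta> by (intro exI[of _ 0]) auto
next
  case False
  \<comment> \<open>\<open>x\<close> solves \<open>x powr s = d powr s + \<eta>\<close>; the slack
    \<open>x - d\<close> is shared equally by the two endpoints.\<close>
  define d x where "d = diameter U" and "x = (d powr s + \<eta>) powr (1 / s)"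
  have d: "d \<ge> 0" unfolding d_def by (rule diameter_ge_0[OF U])
  have "x powr s = d powr s + \<eta>"
    using \<eta> s by (simp add: x_def powr_powr add_nonneg_pos)
  moreover have "d < x"
  proof (rule ccontr)
    assume "\<not> d < x"
    then have "x powr s \<le> d powr s" using s by (intro powr_mono2) (auto simp: x_def)
    then show False using \<open>x powr s = d powr s + \<eta>\<close> \<eta> by simp
  qed
  have bdd: "bdd_above U" "bdd_below U" using U by (auto intro: bounded_imp_bdd_above bounded_imp_bdd_below)
  have "Sup U \<le> y + d" if "y \<in> U" for y
  proof (rule cSup_least[OF False])
    fix z assume "z \<in> U"
    then show "z \<le> y + d"
      using diameter_bounded_bound[OF U, of z y] that unfolding d_def by (simp add: dist_real_def)
  qed
  then have "Sup U - d \<le> Inf U" by (intro cInf_greatest False) (simp add: diff_le_eq)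
  obtain a where a: "Inf U - (x - d) / 2 < of_rat a" "of_rat a < Inf U"
    using of_rat_dense[of "Inf U - (x - d) / 2" "Inf U"] \<open>d < x\<close> by auto
  obtain b where b: "Sup U < of_rat b" "of_rat b < Sup U + (x - d) / 2"
    using of_rat_dense[of "Sup U" "Sup U + (x - d) / 2"] \<open>d < x\<close> by auto
  have "U \<subseteq> {of_rat a<..<of_rat b}"
    using a b cSup_upper[OF _ bdd(1)] cInf_lower[OF _ bdd(2)] by force
  moreover have "diameter {real_of_rat a..of_rat b} \<le> x"
    using a b \<open>Sup U - d \<le> Inf U\<close> \<open>d < x\<close> d by (simp add: field_simps)
  then have "diameter {real_of_rat a..of_rat b} powr s \<le> x powr s"
    using s by (intro powr_mono2) (auto intro: diameter_ge_0)
  ultimately show ?thesis using \<open>x powr s = d powr s + \<eta>\<close> unfolding d_def by metis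
qed

text \<open>A countable cover of sum below \<open>\<epsilon> / 2\<close> is enlarged to open
  rational intervals, with geometric allowances adding up to another \<open>\<epsilon> / 2\<close>.
  Compactness leaves finitely many.\<close>

lemma hausdorff_measure_0_imp_null_content:
  assumes F: "compact F" and s: "s > 0" and H: "hausdorff_measure s F = 0"
  shows "null_content s F"
  unfolding null_content_def
proof (intro allI impI)
  fix \<epsilon> :: real assume \<epsilon>: "\<epsilon> > 0"
  have "hausdorff_pre s 1 F \<le> hausdorff_measure s F"
    unfolding hausdorff_measure_def by (intro SUP_upper) auto
  then have "hausdorff_pre s 1 F < ennreal (\<epsilon> / 2)" using H \<epsilon> by simp
  then obtain U :: "nat \<Rightarrow> real set" where U: "F \<subseteq> (\<Union>i. U i)" "\<And>i. bounded (U i)"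
    and sum: "(\<Sum>i. ennreal (diameter (U i) powr s)) < ennreal (\<epsilon> / 2)"
    unfolding hausdorff_pre_def INF_less_iff by blast
  define \<eta> where "\<eta> i = \<epsilon> / 2 * (1/2) ^ Suc i" for i
  have "\<forall>i. \<exists>a b. U i \<subseteq> {real_of_rat a<..<of_rat b} \<and>
      diameter {real_of_rat a..of_rat b} powr s \<le> diameter (U i) powr s + \<eta> i"
    using U(2) s \<epsilon> by (intro allI enlarge_to_rational_interval) (auto simp: \<eta>_def)
  then obtain a b where ab: "\<And>i. U i \<subseteq> {real_of_rat (a i)<..<of_rat (b i)}"
    "\<And>i. diameter {real_of_rat (a i)..of_rat (b i)} powr s \<le> diameter (U i) powr s + \<eta> i"
    unfolding choice_iff by blast
  have "F \<subseteq> (\<Union>i\<in>UNIV. {real_of_rat (a i)<..<of_rat (b i)})" using U(1) ab(1) by blast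
  then obtain J where J: "finite J" "F \<subseteq> (\<Union>i\<in>J. {real_of_rat (a i)<..<of_rat (b i)})"
    by (rule compactE_image[OF F, rotated]) auto
  define c where "c = map (\<lambda>i. (a i, b i)) (sorted_list_of_set J)"
  have "F \<subseteq> cover c"
  proof
    fix x assume "x \<in> F"
    then obtain i where "i \<in> J" "x \<in> {real_of_rat (a i)<..<of_rat (b i)}" using J(2) by blast
    then show "x \<in> cover c"
      using J(1) by (intro mem_cover[of "a i" "b i"]) (auto simp: c_def)
  qed
  moreover have "weight s c < \<epsilon>"
  proof -
    have "weight s c = (\<Sum>i\<in>J. diameter {real_of_rat (a i)..of_rat (b i)} powr s)"
      using J(1) unfolding weight_def c_def
      by (simp add: sum_list_distinct_conv_sum_set o_def)
    also have "\<dots> \<le> (\<Sum>i\<in>J. diameter (U i) powr s) + (\<Sum>i\<in>J. \<eta> i)"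
      unfolding sum.distrib[symmetric] by (intro sum_mono ab(2))
    also have "(\<Sum>i\<in>J. diameter (U i) powr s) < \<epsilon> / 2"
    proof -
      have "ennreal (\<Sum>i\<in>J. diameter (U i) powr s) = (\<Sum>i\<in>J. ennreal (diameter (U i) powr s))"
        by (simp add: sum_ennreal)
      also have "\<dots> \<le> (\<Sum>i. ennreal (diameter (U i) powr s))"
        by (intro sum_le_suminf J(1)) auto
      finally have "ennreal (\<Sum>i\<in>J. diameter (U i) powr s) < ennreal (\<epsilon> / 2)"
        using sum by (rule le_less_trans)
      then show ?thesis by (simp add: ennreal_less_iff sum_nonneg)
    qed
    also have "(\<Sum>i\<in>J. \<eta> i) \<le> \<epsilon> / 2"
    proof -
      have "\<eta> sums (\<epsilon> / 2 * 1)" unfolding \<eta>_def by (intro sums_mult power_half_series)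
      then show ?thesis using sum_le_suminf[of \<eta> J] J(1) \<epsilon>
        by (simp add: sums_iff \<eta>_def)
    qed
    finally show ?thesis by simp
  qed
  ultimately show "\<exists>c. F \<subseteq> cover c \<and> weight s c < \<epsilon>" by blast
qed

text \<open>Intervals of length \<open>1 / n\<close> covering \<open>{-M..M}\<close> have total
  weight at most \<open>(2 * M + 1) * n powr (1 - s)\<close>, which tends to 0.\<close>

lemma null_content_gt_1:
  assumes F: "bounded F" and s: "s > 1"
  shows "null_content s F"
  unfolding null_content_def
proof (intro allI impI)
  fix \<epsilon> :: real assume \<epsilon>: "\<epsilon> > 0"
  obtain R where R: "\<And>x. x \<in> F \<Longrightarrow> \<bar>x\<bar> \<le> R" using F by (auto simp: bounded_iff)
  obtain M :: nat where M: "R \<le> real M" using real_arch_simple by blast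
  have "(\<lambda>n. real n powr (1 - s)) \<longlonglongrightarrow> 0"
    using s by (intro tendsto_neg_powr filterlim_real_sequentially) auto
  then have "(\<lambda>n. (2 * real M + 1) * real n powr (1 - s)) \<longlonglongrightarrow> 0" by (rule tendsto_mult_right_zero)
  then have "\<forall>\<^sub>F n in sequentially. (2 * real M + 1) * real n powr (1 - s) < \<epsilon>"
    using \<epsilon> by (rule order_tendstoD)
  then have "\<forall>\<^sub>F n in sequentially. (2 * real M + 1) * real n powr (1 - s) < \<epsilon> \<and> n > 0"
    using eventually_gt_at_top by (rule eventually_conj)
  then obtain n where n: "(2 * real M + 1) * real n powr (1 - s) < \<epsilon>" "n > 0"
    using eventually_happens'[OF sequentially_bot] by blast
  define l where "l i = of_nat i / of_nat n - (of_nat M :: rat)" for i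
  have l: "real_of_rat (l i) = real i / real n - real M" for i
    by (simp add: l_def of_rat_diff of_rat_divide)
  \<comment> \<open>The extra interval accommodates \<open>x = M\<close>, where the index reaches
    \<open>2 * M * n\<close>.\<close>
  define c where "c = map (\<lambda>i. (l i, l (Suc i))) [0..<2 * M * n + 1]"
  have "F \<subseteq> cover c"
  proof
    fix x assume "x \<in> F"
    then have x: "- real M \<le> x" "x \<le> real M" using R M by force+
    define i where "i = nat \<lfloor>(x + M) * n\<rfloor>"
    have "(x + M) * n \<ge> 0" using x by simp
    then have i: "real i \<le> (x + M) * n" "(x + M) * n < real i + 1" unfolding i_def by linarith+
    have "(x + real M) * real n \<le> (2 * real M) * real n" using x by (intro mult_right_mono) auto
    then have "real i \<le> real (2 * M * n)" using i by simp
    then have "i < 2 * M * n + 1" by linarith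
    moreover have "x \<in> {real_of_rat (l i)..of_rat (l (Suc i))}"
      using i n(2) unfolding l by (auto simp: field_simps)
    ultimately show "x \<in> cover c"
      by (intro mem_cover[of "l i" "l (Suc i)"]) (auto simp: c_def simp del: upt_Suc)
  qed
  moreover have "weight s c < \<epsilon>"
  proof -
    have "diameter {real_of_rat (l i)..of_rat (l (Suc i))} = 1 / real n" for i
      using n(2) unfolding l by (simp add: field_simps)
    then have "weight s c = real (2 * M * n + 1) * (1 / real n) powr s"
      unfolding weight_def c_def by (simp add: o_def sum_list_triv del: upt_Suc diameter_closed_interval)
    also have "\<dots> = real (2 * M * n + 1) * real n powr - s"
      using n(2) by (simp add: powr_minus powr_divide inverse_eq_divide)
    also have "\<dots> \<le> ((2 * real M + 1) * real n) * real n powr - s"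
      using n(2) by (intro mult_right_mono) (auto simp: algebra_simps)
    also have "\<dots> = (2 * real M + 1) * (real n powr 1 * real n powr - s)" using n(2) by simp
    also have "\<dots> = (2 * real M + 1) * real n powr (1 - s)"
      unfolding powr_add[symmetric] by simp
    finally show ?thesis using n(1) by simp
  qed
  ultimately show "\<exists>c. F \<subseteq> cover c \<and> weight s c < \<epsilon>" by blast
qed

lemma hausdorff_dim_eq_Inf_null_content:
  "compact F \<Longrightarrow> hausdorff_dim F = Inf {s. s > 0 \<and> null_content s F}"
  unfolding hausdorff_dim_def
  by (intro arg_cong[where f = Inf] Collect_cong conj_cong refl)
    (blast intro: null_content_imp_hausdorff_measure_0 hausdorff_measure_0_imp_null_content)

lemma hausdorff_dim_unit:
  assumes "compact F"
  shows "0 \<le> hausdorff_dim F" "hausdorff_dim F \<le> 1"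
proof -
  let ?S = "{s. s > 0 \<and> null_content s F}"
  have gt: "s \<in> ?S" if "s > 1" for s
    using null_content_gt_1 compact_imp_bounded assms that by auto
  have bdd: "bdd_below ?S" by (rule bdd_belowI[of _ 0]) auto
  show "0 \<le> hausdorff_dim F" unfolding hausdorff_dim_eq_Inf_null_content[OF assms]
    using gt[of 2] by (intro cInf_greatest) fastforce+
  show "hausdorff_dim F \<le> 1" unfolding hausdorff_dim_eq_Inf_null_content[OF assms]
    by (rule dense_ge) (intro cInf_lower gt bdd)
qed

lemma not_null_content_of_less_hausdorff_dim:
  assumes "compact F" "0 < s" "s < hausdorff_dim F"
  shows "\<not> null_content s F"
proof
  assume "null_content s F"
  then have "Inf {s. s > 0 \<and> null_content s F} \<le> s"
    using assms(2) by (intro cInf_lower bdd_belowI[of _ 0]) auto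
  then show False using assms hausdorff_dim_eq_Inf_null_content by simp
qed

text \<open>By monotonicity a null exponent at most \<open>s\<close> would make \<open>s\<close>
  null, so all null exponents exceed \<open>s\<close>.\<close>

lemma le_hausdorff_dim_of_not_null_content:
  assumes "compact F" "\<not> null_content s F"
  shows "s \<le> hausdorff_dim F"
  unfolding hausdorff_dim_eq_Inf_null_content[OF assms(1)]
proof (rule cInf_greatest)
  show "{s. s > 0 \<and> null_content s F} \<noteq> {}"
    using null_content_gt_1[OF compact_imp_bounded[OF assms(1)], of 2] by fastforce
  fix t assume "t \<in> {s. s > 0 \<and> null_content s F}"
  then show "s \<le> t" using null_content_mono[of t F s] assms(2) by force
qed

section \<open>Dyadic exponents and the tower for the Hausdorff dimension\<close>

definition dyadic_grid :: "nat \<Rightarrow> rat set" where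
  "dyadic_grid n = (\<lambda>j. of_nat j / 2^n) ` {1..2^n}"

lemma finite_dyadic_grid: "finite (dyadic_grid n)"
  by (simp add: dyadic_grid_def)

lemma dyadic_grid_unit: "s \<in> dyadic_grid n \<Longrightarrow> 0 < s \<and> s \<le> 1"
  by (auto simp: dyadic_grid_def)

lemma dyadic_grid_Suc: "dyadic_grid n \<subseteq> dyadic_grid (Suc n)"
proof
  fix s assume "s \<in> dyadic_grid n"
  then obtain j where "j \<in> {1..2^n}" "s = of_nat j / 2^n" by (auto simp: dyadic_grid_def)
  then show "s \<in> dyadic_grid (Suc n)"
    unfolding dyadic_grid_def by (intro image_eqI[of _ _ "2 * j"]) auto
qed

lemma dyadic_grid_mono: "m \<le> n \<Longrightarrow> dyadic_grid m \<subseteq> dyadic_grid n"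
  by (rule lift_Suc_mono_le[of dyadic_grid]) (rule dyadic_grid_Suc)

lemma dyadic_grid_dense:
  assumes "0 \<le> x" "x < y" "y \<le> (1::real)"
  obtains n s where "s \<in> dyadic_grid n" "x < of_rat s" "of_rat s < y"
proof -
  obtain n where n: "(1/2)^n < y - x" using real_arch_pow_inv[of "y - x" "1/2"] assms by auto
  \<comment> \<open>The first integer above \<open>x * 2^n\<close>; adding 1 to the floor makes the
    inequality strict and ensures \<open>j \<ge> 1\<close>.\<close>
  define j where "j = nat \<lfloor>x * 2^n\<rfloor> + 1"
  have "x * 2^n \<ge> 0" using assms by simp
  then have j: "x * 2^n < real j" "real j \<le> x * 2^n + 1" unfolding j_def by linarith+
  have "1 < (y - x) * 2^n" using n by (simp add: power_one_over field_simps)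
  then have jy: "real j < y * 2^n" using j by (simp add: left_diff_distrib)
  also have "\<dots> \<le> 1 * 2^n" using assms by (intro mult_right_mono) auto
  finally have "real j \<le> real (2^n)" by simp
  then have "j \<le> 2^n" by (simp only: of_nat_le_iff)
  then have "of_nat j / 2^n \<in> dyadic_grid n" unfolding dyadic_grid_def
    by (intro imageI) (simp add: j_def)
  moreover have "real_of_rat (of_nat j / 2^n) = real j / 2^n" by (simp add: of_rat_divide of_rat_power)
  moreover have "x < real j / 2^n" "real j / 2^n < y" using j jy by (simp_all add: field_simps)
  ultimately show ?thesis by (intro that[of "of_nat j / 2^n" n]) simp_all
qed

text \<open>\<open>P\<close> selects the admissible covers, so the same notion serves observed,
  enumerated and actual covers. The real weights are compared inside the map applied to
  observations, not by tree tests.\<close>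

definition heavy :: "nat \<Rightarrow> rat \<Rightarrow> ((rat \<times> rat) list \<Rightarrow> bool) \<Rightarrow> bool" where
  "heavy n s P \<longleftrightarrow> (\<forall>c. P c \<longrightarrow> weight (of_rat s) c \<ge> 1 / (real n + 1))"

text \<open>The inserted 0 is the value when no grid exponent is heavy, as for a set of dimension
  0.\<close>

definition heavy_exponent :: "nat \<Rightarrow> ((rat \<times> rat) list \<Rightarrow> bool) \<Rightarrow> rat" where
  "heavy_exponent n P = Max (insert 0 {s \<in> dyadic_grid n. heavy n s P})"

lemma heavy_exponent_unit: "0 \<le> heavy_exponent n P" "heavy_exponent n P \<le> 1"
  unfolding heavy_exponent_def using dyadic_grid_unit
  by (auto simp: finite_dyadic_grid)

lemma incseq_heavy_exponent: "incseq (\<lambda>n. heavy_exponent n P)"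
proof (rule incseq_SucI)
  fix n
  have "1 / (real (Suc n) + 1) \<le> 1 / (real n + 1)" by (simp add: field_simps)
  then have "heavy (Suc n) s P" if "heavy n s P" for s
    using that unfolding heavy_def by (meson order_trans)
  then show "heavy_exponent n P \<le> heavy_exponent (Suc n) P"
    unfolding heavy_exponent_def using dyadic_grid_Suc
    by (intro Max_mono) (auto simp: finite_dyadic_grid)
qed

text \<open>A heavy exponent is not null, hence at most the dimension. Conversely, a grid point
  between \<open>y\<close> and the dimension has cover weights bounded away from 0 and becomes heavy
  once \<open>n\<close> is large.\<close>

lemma heavy_exponent_tendsto_hausdorff_dim:
  assumes F: "compact F"
  shows "(\<lambda>n. real_of_rat (heavy_exponent n (\<lambda>c. F \<subseteq> cover c))) \<longlonglongrightarrow> hausdorff_dim F"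
proof (rule order_tendstoI)
  let ?P = "\<lambda>c. F \<subseteq> cover c"
  have le: "real_of_rat (heavy_exponent n ?P) \<le> hausdorff_dim F" for n
  proof -
    have "heavy_exponent n ?P \<in> insert 0 {s \<in> dyadic_grid n. heavy n s ?P}"
      unfolding heavy_exponent_def by (rule Max_in) (auto simp: finite_dyadic_grid)
    then consider "heavy_exponent n ?P = 0" | "heavy n (heavy_exponent n ?P) ?P" by blast
    then show ?thesis
    proof cases
      case 1
      then show ?thesis using hausdorff_dim_unit[OF F] by simp
    next
      case 2
      have "1 / (real n + 1) > 0" by simp
      then have "\<not> null_content (of_rat (heavy_exponent n ?P)) F"
        using 2 unfolding heavy_def null_content_def by (meson not_less)
      then show ?thesis by (rule le_hausdorff_dim_of_not_null_content[OF F])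
    qed
  qed
  fix y
  {
    assume "hausdorff_dim F < y"
    then have "real_of_rat (heavy_exponent n ?P) < y" for n using le[of n] by linarith
    then show "\<forall>\<^sub>F n in sequentially. real_of_rat (heavy_exponent n ?P) < y"
      by (intro always_eventually allI)
  next
    assume y: "y < hausdorff_dim F"
    show "\<forall>\<^sub>F n in sequentially. y < real_of_rat (heavy_exponent n ?P)"
    proof (cases "y < 0")
      case True
      then have "y < real_of_rat (heavy_exponent n ?P)" for n
        using heavy_exponent_unit(1)[of n ?P] by (meson less_le_trans zero_le_of_rat_iff)
      then show ?thesis by (intro always_eventually allI)
    next
      case False
      then obtain m s where s: "s \<in> dyadic_grid m" "y < of_rat s" "of_rat s < hausdorff_dim F"
        using dyadic_grid_dense[OF _ y hausdorff_dim_unit(2)[OF F]] by (metis not_less)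
      have "\<not> null_content (of_rat s) F"
        using s dyadic_grid_unit[OF s(1)] by (intro not_null_content_of_less_hausdorff_dim F) auto
      then obtain \<epsilon> where \<epsilon>: "\<epsilon> > 0" "\<And>c. F \<subseteq> cover c \<Longrightarrow> weight (of_rat s) c \<ge> \<epsilon>"
        unfolding null_content_def by (meson not_less)
      obtain k where k: "1 / real (Suc k) < \<epsilon>" using nat_approx_posE[OF \<epsilon>(1)] .
      have "y < real_of_rat (heavy_exponent n ?P)" if n: "n \<ge> max m k" for n
      proof -
        have "1 / (real n + 1) \<le> 1 / real (Suc k)" using n by (intro divide_left_mono) auto
        then have "1 / (real n + 1) \<le> \<epsilon>" using k by simp
        then have "heavy n s ?P" unfolding heavy_def using \<epsilon>(2) by (meson order_trans)
        moreover have "s \<in> dyadic_grid n" using s(1) dyadic_grid_mono[of m n] n by auto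
        ultimately have "s \<le> heavy_exponent n ?P"
          unfolding heavy_exponent_def by (intro Max_ge) (auto simp: finite_dyadic_grid)
        then have "real_of_rat s \<le> of_rat (heavy_exponent n ?P)" by (simp add: of_rat_less_eq)
        then show ?thesis using s(2) by linarith
      qed
      then show ?thesis by (rule eventually_sequentiallyI)
    qed
  }
qed

text \<open>Only finitely many grid exponents are examined, so the maximum is eventually constant
  once each of them settles.\<close>

lemma heavy_exponent_tendsto:
  assumes "\<And>s. \<forall>\<^sub>F m in sequentially. heavy n s (P m) \<longleftrightarrow> heavy n s Q"
  shows "(\<lambda>m. real_of_rat (heavy_exponent n (P m))) \<longlonglongrightarrow> of_rat (heavy_exponent n Q)"
  unfolding heavy_exponent_def
  by (intro tendsto_fun_eventually_eq[where f = "\<lambda>S. real_of_rat (Max (insert 0 S))"]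
      eventually_Collect_eq finite_dyadic_grid assms)

text \<open>A set fails to cover the spectrum exactly when its open complement meets it, which
  detection settles in the first limit. The second limit admits all covers, and the third refines
  grid and threshold.\<close>

theorem (in spectral_observation) hausdorff_dim_Sigma3:
  "Sigma3_A Om Lam (\<lambda>A. hausdorff_dim (Spec A))"
  unfolding Sigma3_A_def
proof (intro exI conjI allI ballI)
  let ?C = "\<lambda>n2. from_nat ` {..n2} :: (rat \<times> rat) list set"
  let ?g = "\<lambda>n3 n2 W. heavy_exponent n3 (\<lambda>c. c \<in> ?C n2 \<and> \<not> detects W (- cover c))"
  let ?G = "\<lambda>n3 n2 n1 A. real_of_rat (?g n3 n2 (obs n1 A))"
  let ?G2 = "\<lambda>n3 n2 A. real_of_rat (heavy_exponent n3 (\<lambda>c. c \<in> ?C n2 \<and> Spec A \<subseteq> cover c))"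
  let ?G3 = "\<lambda>n3 A. real_of_rat (heavy_exponent n3 (\<lambda>c. Spec A \<subseteq> cover c))"
  show "arith_alg Om Lam (?G n3 n2 n1)" for n3 n2 n1 by (rule arith_alg_obs)
  show "?G n3 n2 n1 A \<in> {0..1}" for n3 n2 n1 A
    by (intro of_rat_in_unit heavy_exponent_unit)
  fix A assume A: "A \<in> Om"
  show "(\<lambda>n1. ?G n3 n2 n1 A) \<longlonglongrightarrow> ?G2 n3 n2 A" for n3 n2
  proof (rule heavy_exponent_tendsto)
    fix s
    have "\<forall>\<^sub>F n1 in sequentially. detects (obs n1 A) (- cover c) \<longleftrightarrow> - cover c \<inter> Spec A \<noteq> {}" for c
      by (intro eventually_detects_iff A open_Compl closed_cover)
    then have "\<forall>\<^sub>F n1 in sequentially. \<forall>c\<in>?C n2.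
        detects (obs n1 A) (- cover c) \<longleftrightarrow> - cover c \<inter> Spec A \<noteq> {}"
      by (intro eventually_ball_finite) auto
    then show "\<forall>\<^sub>F n1 in sequentially.
        heavy n3 s (\<lambda>c. c \<in> ?C n2 \<and> \<not> detects (obs n1 A) (- cover c)) \<longleftrightarrow>
        heavy n3 s (\<lambda>c. c \<in> ?C n2 \<and> Spec A \<subseteq> cover c)"
    proof (rule eventually_mono)
      fix n1 assume *: "\<forall>c\<in>?C n2. detects (obs n1 A) (- cover c) \<longleftrightarrow> - cover c \<inter> Spec A \<noteq> {}"
      have "(c \<in> ?C n2 \<and> \<not> detects (obs n1 A) (- cover c)) \<longleftrightarrow> (c \<in> ?C n2 \<and> Spec A \<subseteq> cover c)" for c
        using bspec[OF *, of c] by blast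
      then show "heavy n3 s (\<lambda>c. c \<in> ?C n2 \<and> \<not> detects (obs n1 A) (- cover c)) \<longleftrightarrow>
        heavy n3 s (\<lambda>c. c \<in> ?C n2 \<and> Spec A \<subseteq> cover c)" by simp
    qed
  qed
  show "(\<lambda>n2. ?G2 n3 n2 A) \<longlonglongrightarrow> ?G3 n3 A" for n3
  proof (rule heavy_exponent_tendsto)
    fix s
    show "\<forall>\<^sub>F n2 in sequentially. heavy n3 s (\<lambda>c. c \<in> ?C n2 \<and> Spec A \<subseteq> cover c) \<longleftrightarrow>
        heavy n3 s (\<lambda>c. Spec A \<subseteq> cover c)"
    \<comment> \<open>Fewer covers cannot destroy heaviness; a light cover \<open>c\<close> refutes
      it from stage \<open>to_nat c\<close> on.\<close>
    proof (cases "heavy n3 s (\<lambda>c. Spec A \<subseteq> cover c)")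
      case True
      then have "heavy n3 s (\<lambda>c. c \<in> ?C n2 \<and> Spec A \<subseteq> cover c)" for n2
        unfolding heavy_def by blast
      then show ?thesis using True by simp
    next
      case False
      then obtain c where c: "Spec A \<subseteq> cover c" "\<not> 1 / (real n3 + 1) \<le> weight (of_rat s) c"
        unfolding heavy_def by blast
      have "\<not> heavy n3 s (\<lambda>c. c \<in> ?C n2 \<and> Spec A \<subseteq> cover c)" if "n2 \<ge> to_nat c" for n2
      proof -
        have "c \<in> ?C n2" using that by (intro image_eqI[of _ _ "to_nat c"]) auto
        then show ?thesis using c unfolding heavy_def by blast
      qed
      then show ?thesis using False by (intro eventually_sequentiallyI[of "to_nat c"]) blast
    qed
  qed
  show "(\<lambda>n3. ?G3 n3 A) \<longlonglongrightarrow> hausdorff_dim (Spec A)"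
    by (intro heavy_exponent_tendsto_hausdorff_dim compact_Spec A)
  show "incseq (\<lambda>n3. ?G3 n3 A)"
    using incseq_heavy_exponent by (auto simp: incseq_def of_rat_less_eq)
qed

theorem theorem5p4:
  fixes Om :: "('h::{real_inner,complete_space} \<Rightarrow>\<^sub>L 'h) set"
    and Lam :: "(('h \<Rightarrow>\<^sub>L 'h) \<Rightarrow> complex) set"
  assumes nontriv: "\<exists>x::'h. x \<noteq> 0"
    and separable: "\<exists>D::'h set. countable D \<and> closure D = UNIV"
    and selfadj: "\<forall>A\<in>Om. self_adjoint A"
    and S2: "assumption_S2 Om Lam Sp"
  shows "Sigma3_A Om Lam (\<lambda>A. lower_box_dim (Sp A)) \<and>
         Pi2_A Om Lam (\<lambda>A. upper_box_dim (Sp A)) \<and>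
         Sigma3_A Om Lam (\<lambda>A. hausdorff_dim (Sp A)) \<and>
         Pi2_A {A\<in>Om. lower_box_dim (Sp A) = upper_box_dim (Sp A)} Lam (\<lambda>A. lower_box_dim (Sp A))"
proof -
  obtain obs where "spectral_observation Om Lam Sp obs"
    using spectral_observation_exists[OF S2] compact_Sp Sp_nonempty[OF _ nontriv] selfadj by blast
  then interpret spectral_observation Om Lam Sp obs .
  \<comment> \<open>Both box dimensions agree on this class, so the tower for the upper one
    restricts to it.\<close>
  have "Pi2_A {A\<in>Om. lower_box_dim (Sp A) = upper_box_dim (Sp A)} Lam (\<lambda>A. lower_box_dim (Sp A))"
    by (rule Pi2_A_subset_cong[OF upper_box_dim_Pi2]) auto
  then show ?thesis using lower_box_dim_Sigma3 upper_box_dim_Pi2 hausdorff_dim_Sigma3 by blast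
qed

end
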